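(* Let $(\mathcal{A},\Delta)$ be a Hopf algebra over $\mathbb{C}$, let $\mathcal{E}$ be a finite bicovariant $\mathcal{A}$-bimodule and let $g:\mathcal{E}\otimes_{\mathcal{A}}\mathcal{E}\to\mathcal{A}$ be a pseudo-Riemannian metric on $\mathcal{E}$. Then $g$ is left-invariant if and only if $g$ is a left-covariant map, i.e. $(\mathrm{id}\otimes g)\circ\Delta_{\mathcal{E}\otimes_{\mathcal{A}}\mathcal{E}}=\Delta\circ g$. Similarly, $g$ is right-invariant if and only if $g$ is a right-covariant map, i.e. $(g\otimes\mathrm{id})\circ{}_{\mathcal{E}\otimes_{\mathcal{A}}\mathcal{E}}\Delta=\Delta\circ g$.
   Context: All vector spaces are over $\mathbb{C}$; $\epsilon$ is the counit. Left coactions are written $\Delta_M(m)=m_{(-1)}\otimes m_{(0)}\in\mathcal{A}\otimes_{\mathbb{C}}M$ and right coactions ${}_M\Delta(m)=m_{(0)}\otimes m_{(1)}\in M\otimes_{\mathbb{C}}\mathcal{A}$. Bicovariant bimodule $(M,\Delta_M,{}_M\Delta)$: an $\mathcal{A}$-bimodule that is a left and a right $\mathcal{A}$-comodule with $(\mathrm{id}\otimes{}_M\Delta)\Delta_M=(\Delta_M\otimes\mathrm{id}){}_M\Delta$ and $\Delta_M(am)=\Delta(a)\Delta_M(m)$, $\Delta_M(ma)=\Delta_M(m)\Delta(a)$, ${}_M\Delta(am)=\Delta(a){}_M\Delta(m)$, ${}_M\Delta(ma)={}_M\Delta(m)\Delta(a)$. ${}_0M=\{m:\Delta_M(m)=1\otimes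 m\}$, $M_0=\{m:{}_M\Delta(m)=m\otimes1\}$; $M$ is finite if $\dim_{\mathbb{C}}{}_0M<\infty$. $M\otimes_{\mathcal{A}}N$ has coactions $\Delta_{M\otimes_{\mathcal{A}}N}(m\otimes n)=m_{(-1)}n_{(-1)}\otimes m_{(0)}\otimes_{\mathcal{A}}n_{(0)}$, ${}_{M\otimes_{\mathcal{A}}N}\Delta(m\otimes n)=m_{(0)}\otimes_{\mathcal{A}}n_{(0)}\otimes m_{(1)}n_{(1)}$. $\mathcal{A}$ is a left and right comodule over itself via $\Delta$. Braiding (Woronowicz, known): $\sigma:\mathcal{E}\otimes_{\mathcal{A}}\mathcal{E}\to\mathcal{E}\otimes_{\mathcal{A}}\mathcal{E}$ is the unique $\mathcal{A}$-bimodule map with $\sigma(\omega\otimes_{\mathcal{A}}\eta)=\eta\otimes_{\mathcal{A}}\omega$ for $\omega\in{}_0\mathcal{E}$, $\eta\in\mathcal{E}_0$. A pseudo-Riemannian metric on $\mathcal{E}$ is a right $\mathcal{A}$-linear map $g:\mathcal{E}\otimes_{\mathcal{A}}\mathcal{E}\to\mathcal{A}$ with (i) $g\circ\sigma=g$; (ii) if $g(\rho\otimes_{\mathcal{A}}\nu)=0$ for all $\nu\in\mathcal{E}$ then $\rho=0$. It is left-invariant if $(\mathrm{id}\otimes\epsilon g)\Delta_{\mathcal{E}\otimes_{\mathcal{A}}\mathcal{E}}(\rho\otimes_{\mathcal{A}}\nu)=g(\rho\otimes_{\mathcal{A}}\nu)$ for all $\rho,\nu\in\mathcal{E}$, and right-invariant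 if $(\epsilon g\otimes\mathrm{id})\,{}_{\mathcal{E}\otimes_{\mathcal{A}}\mathcal{E}}\Delta(\rho\otimes_{\mathcal{A}}\nu)=g(\rho\otimes_{\mathcal{A}}\nu)$ for all $\rho,\nu\in\mathcal{E}$. *)

theory Defs
  imports Complex_Main "HOL-Library.Poly_Mapping" "HOL-Algebra.Module" "HOL-Algebra.AbelCoset"
begin

section \<open>Complex vector spaces\<close>

text \<open>
  A complex vector space is a record \<open>V\<close> with \<open>module complex_alg V\<close>.  As usual for
  \<^locale>\<open>module\<close>, the fields \<open>mult\<close> and \<open>one\<close> carry no meaning unless \<open>V\<close> is an algebra.
\<close>

definition complex_alg :: "(complex, complex) module" where
  "complex_alg = \<lparr>carrier = UNIV, mult = (*), one = 1, zero = 0, add = (+), smult = (*)\<rparr>"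

definition linear_map ::
  "(complex, 'm, 'x) module_scheme \<Rightarrow> (complex, 'n, 'y) module_scheme \<Rightarrow> ('m \<Rightarrow> 'n) \<Rightarrow> bool" where
  "linear_map M N f \<longleftrightarrow> f \<in> carrier M \<rightarrow> carrier N \<and>
     (\<forall>x\<in>carrier M. \<forall>y\<in>carrier M. f (x \<oplus>\<^bsub>M\<^esub> y) = f x \<oplus>\<^bsub>N\<^esub> f y) \<and>
     (\<forall>c. \<forall>x\<in>carrier M. f (c \<odot>\<^bsub>M\<^esub> x) = c \<odot>\<^bsub>N\<^esub> f x)"

definition bilinear_map ::
  "(complex, 'm, 'x) module_scheme \<Rightarrow> (complex, 'n, 'y) module_scheme \<Rightarrow>
   (complex, 'p, 'z) module_scheme \<Rightarrow> ('m \<Rightarrow> 'n \<Rightarrow> 'p) \<Rightarrow> bool" where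
  "bilinear_map M N P \<beta> \<longleftrightarrow>
     (\<forall>m\<in>carrier M. linear_map N P (\<beta> m)) \<and> (\<forall>n\<in>carrier N. linear_map M P (\<lambda>m. \<beta> m n))"

definition linear_span :: "(complex, 'v, 'x) module_scheme \<Rightarrow> 'v set \<Rightarrow> 'v set" where
  "linear_span V S = (\<lambda>W. submodule W complex_alg V) hull S"

definition quotient_space ::
  "(complex, 'v, 'x) module_scheme \<Rightarrow> 'v set \<Rightarrow> (complex, 'v set) module" where
  "quotient_space V W =
     \<lparr>carrier = a_rcosets\<^bsub>V\<^esub> W, mult = undefined, one = undefined, zero = W,
      add = set_add V, smult = (\<lambda>c X. \<Union>x\<in>X. W +>\<^bsub>V\<^esub> (c \<odot>\<^bsub>V\<^esub> x))\<rparr>"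

definition free_space :: "'s set \<Rightarrow> (complex, 's \<Rightarrow>\<^sub>0 complex) module" where
  "free_space S =
     \<lparr>carrier = {x. Poly_Mapping.keys x \<subseteq> S}, mult = undefined, one = undefined, zero = 0,
      add = (+), smult = (\<lambda>c. Poly_Mapping.map ((*) c))\<rparr>"


section \<open>Tensor products\<close>

text \<open>
  \<open>tensor_by X M N\<close> is the free vector space on \<open>carrier M \<times> carrier N\<close> modulo the relations of
  bilinearity and the additional relations \<open>X\<close>: \<open>X = {}\<close> gives the tensor product over the complex
  numbers, and the balancing relations for an algebra \<open>A\<close> give the tensor product over \<open>A\<close>.
  Elements of a tensor product are cosets of formal linear combinations of pairs.
\<close>

type_synonym ('m, 'n) tens = "('m \<times> 'n \<Rightarrow>\<^sub>0 complex) set"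

abbreviation pair_of :: "'m \<Rightarrow> 'n \<Rightarrow> ('m \<times> 'n \<Rightarrow>\<^sub>0 complex)" where
  "pair_of m n \<equiv> Poly_Mapping.single (m, n) 1"

definition bilinear_relations ::
  "(complex, 'm, 'x) module_scheme \<Rightarrow> (complex, 'n, 'y) module_scheme \<Rightarrow>
   ('m \<times> 'n \<Rightarrow>\<^sub>0 complex) set" where
  "bilinear_relations M N =
     {pair_of (m \<oplus>\<^bsub>M\<^esub> m') n - pair_of m n - pair_of m' n | m m' n.
        m \<in> carrier M \<and> m' \<in> carrier M \<and> n \<in> carrier N} \<union>
     {pair_of m (n \<oplus>\<^bsub>N\<^esub> n') - pair_of m n - pair_of m n' | m n n'.
        m \<in> carrier M \<and> n \<in> carrier N \<and> n' \<in> carrier N} \<union>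
     {pair_of (c \<odot>\<^bsub>M\<^esub> m) n - Poly_Mapping.single (m, n) c | c m n.
        m \<in> carrier M \<and> n \<in> carrier N} \<union>
     {pair_of m (c \<odot>\<^bsub>N\<^esub> n) - Poly_Mapping.single (m, n) c | c m n.
        m \<in> carrier M \<and> n \<in> carrier N}"

definition relation_space ::
  "('m \<times> 'n \<Rightarrow>\<^sub>0 complex) set \<Rightarrow> (complex, 'm, 'x) module_scheme \<Rightarrow>
   (complex, 'n, 'y) module_scheme \<Rightarrow> ('m \<times> 'n \<Rightarrow>\<^sub>0 complex) set" where
  "relation_space X M N =
     linear_span (free_space (carrier M \<times> carrier N)) (bilinear_relations M N \<union> X)"

definition tensor_by ::
  "('m \<times> 'n \<Rightarrow>\<^sub>0 complex) set \<Rightarrow> (complex, 'm, 'x) module_scheme \<Rightarrow>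
   (complex, 'n, 'y) module_scheme \<Rightarrow> (complex, ('m, 'n) tens) module" where
  "tensor_by X M N =
     quotient_space (free_space (carrier M \<times> carrier N)) (relation_space X M N)"

definition tens_by ::
  "('m \<times> 'n \<Rightarrow>\<^sub>0 complex) set \<Rightarrow> (complex, 'm, 'x) module_scheme \<Rightarrow>
   (complex, 'n, 'y) module_scheme \<Rightarrow> 'm \<Rightarrow> 'n \<Rightarrow> ('m, 'n) tens" where
  "tens_by X M N m n =
     relation_space X M N +>\<^bsub>free_space (carrier M \<times> carrier N)\<^esub> pair_of m n"

abbreviation tensor where "tensor \<equiv> tensor_by {}"
abbreviation tens where "tens \<equiv> tens_by {}"

text \<open>
  \<open>lift P \<beta>\<close> is the linear map with values in \<open>P\<close>, defined on a tensor product, that sends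
  \<open>m \<otimes> n\<close> to \<open>\<beta> m n\<close>.  It takes the common value of \<open>\<beta>\<close>, extended linearly, on all
  representatives of a coset; such a value exists because every \<open>\<beta>\<close> used below respects the
  defining relations.
\<close>

definition eval_formal ::
  "(complex, 'p, 'z) module_scheme \<Rightarrow> ('m \<Rightarrow> 'n \<Rightarrow> 'p) \<Rightarrow> ('m \<times> 'n \<Rightarrow>\<^sub>0 complex) \<Rightarrow> 'p" where
  "eval_formal P \<beta> x =
     (\<Oplus>\<^bsub>P\<^esub>p\<in>Poly_Mapping.keys x. Poly_Mapping.lookup x p \<odot>\<^bsub>P\<^esub> \<beta> (fst p) (snd p))"

definition lift ::
  "(complex, 'p, 'z) module_scheme \<Rightarrow> ('m \<Rightarrow> 'n \<Rightarrow> 'p) \<Rightarrow> ('m, 'n) tens \<Rightarrow> 'p" where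
  "lift P \<beta> t = the_elem (eval_formal P \<beta> ` t)"

text \<open>The map \<open>f \<otimes> g\<close>, where \<open>M'\<close> and \<open>N'\<close> are the codomains of \<open>f\<close> and \<open>g\<close>.\<close>

definition tensor_map ::
  "(complex, 'p, 'x) module_scheme \<Rightarrow> (complex, 'q, 'y) module_scheme \<Rightarrow>
   ('m \<Rightarrow> 'p) \<Rightarrow> ('n \<Rightarrow> 'q) \<Rightarrow> ('m, 'n) tens \<Rightarrow> ('p, 'q) tens" where
  "tensor_map M' N' f g = lift (tensor M' N') (\<lambda>m n. tens M' N' (f m) (g n))"

text \<open>The canonical map \<open>(U \<otimes> V) \<otimes> W \<rightarrow> U \<otimes> (V \<otimes> W)\<close>.\<close>

definition tensor_assoc ::
  "(complex, 'u, 'x) module_scheme \<Rightarrow> (complex, 'v, 'y) module_scheme \<Rightarrow>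
   (complex, 'w, 'z) module_scheme \<Rightarrow> (('u, 'v) tens, 'w) tens \<Rightarrow> ('u, ('v, 'w) tens) tens" where
  "tensor_assoc U V W =
     lift (tensor U (tensor V W))
       (\<lambda>s w. lift (tensor U (tensor V W)) (\<lambda>u v. tens U (tensor V W) u (tens V W v w)) s)"

text \<open>
  Componentwise product: for \<open>\<beta> : M \<times> N \<rightarrow> P\<close> and \<open>\<beta>' : M' \<times> N' \<rightarrow> P'\<close> bilinear,
  \<open>(m \<otimes> m') \<cdot> (n \<otimes> n') = \<beta> m n \<otimes> \<beta>' m' n'\<close>.  All products of the form \<open>\<Delta>(a) \<Delta>\<^sub>M(m)\<close>
  are instances of it.
\<close>

definition tensor_mult ::
  "(complex, 'p, 'x) module_scheme \<Rightarrow> (complex, 'q, 'y) module_scheme \<Rightarrow>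
   ('m \<Rightarrow> 'n \<Rightarrow> 'p) \<Rightarrow> ('k \<Rightarrow> 'l \<Rightarrow> 'q) \<Rightarrow> ('m, 'k) tens \<Rightarrow> ('n, 'l) tens \<Rightarrow> ('p, 'q) tens" where
  "tensor_mult P P' \<beta> \<beta>' s t =
     lift (tensor P P')
       (\<lambda>m m'. lift (tensor P P') (\<lambda>n n'. tens P P' (\<beta> m n) (\<beta>' m' n')) t) s"


section \<open>Hopf algebras\<close>

record 'a hopf_alg = "(complex, 'a) module" +
  comult :: "'a \<Rightarrow> ('a, 'a) tens"
  counit :: "'a \<Rightarrow> complex"
  antipode :: "'a \<Rightarrow> 'a"

locale hopf_algebra = module complex_alg A + ring A for A :: "'a hopf_alg" (structure) +
  assumes mult_bilinear: "bilinear_map A A A (mult A)"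
    and comult_linear: "linear_map A (tensor A A) (comult A)"
    and comult_coassoc: "a \<in> carrier A \<Longrightarrow>
      tensor_assoc A A A (tensor_map (tensor A A) A (comult A) id (comult A a)) =
      tensor_map A (tensor A A) id (comult A) (comult A a)"
    and counit_linear: "linear_map A complex_alg (counit A)"
    and counit_left: "a \<in> carrier A \<Longrightarrow> lift A (\<lambda>b c. counit A b \<odot> c) (comult A a) = a"
    and counit_right: "a \<in> carrier A \<Longrightarrow> lift A (\<lambda>b c. counit A c \<odot> b) (comult A a) = a"
    and comult_mult: "\<lbrakk>a \<in> carrier A; b \<in> carrier A\<rbrakk> \<Longrightarrow>
      comult A (a \<otimes> b) = tensor_mult A A (mult A) (mult A) (comult A a) (comult A b)"
    and comult_one: "comult A \<one> = tens A A \<one> \<one>"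
    and counit_mult: "\<lbrakk>a \<in> carrier A; b \<in> carrier A\<rbrakk> \<Longrightarrow>
      counit A (a \<otimes> b) = counit A a * counit A b"
    and counit_one: "counit A \<one> = 1"
    and antipode_linear: "linear_map A A (antipode A)"
    and antipode_left: "a \<in> carrier A \<Longrightarrow>
      lift A (\<lambda>b c. antipode A b \<otimes> c) (comult A a) = counit A a \<odot> \<one>"
    and antipode_right: "a \<in> carrier A \<Longrightarrow>
      lift A (\<lambda>b c. b \<otimes> antipode A c) (comult A a) = counit A a \<odot> \<one>"


section \<open>Bicovariant bimodules\<close>

record ('a, 'm) bicov = "(complex, 'm) module" +
  lact :: "'a \<Rightarrow> 'm \<Rightarrow> 'm"
  ract :: "'m \<Rightarrow> 'a \<Rightarrow> 'm"
  lcoact :: "'m \<Rightarrow> ('a, 'm) tens"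
  rcoact :: "'m \<Rightarrow> ('m, 'a) tens"

locale bimodule = module complex_alg M for A :: "'a hopf_alg" and M :: "('a, 'm) bicov" +
  assumes lact_bilinear: "bilinear_map A M M (lact M)"
    and lact_mult: "\<lbrakk>a \<in> carrier A; b \<in> carrier A; m \<in> carrier M\<rbrakk> \<Longrightarrow>
      lact M (a \<otimes>\<^bsub>A\<^esub> b) m = lact M a (lact M b m)"
    and lact_one: "m \<in> carrier M \<Longrightarrow> lact M \<one>\<^bsub>A\<^esub> m = m"
    and ract_bilinear: "bilinear_map M A M (ract M)"
    and ract_mult: "\<lbrakk>a \<in> carrier A; b \<in> carrier A; m \<in> carrier M\<rbrakk> \<Longrightarrow>
      ract M m (a \<otimes>\<^bsub>A\<^esub> b) = ract M (ract M m a) b"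
    and ract_one: "m \<in> carrier M \<Longrightarrow> ract M m \<one>\<^bsub>A\<^esub> = m"
    and lact_ract: "\<lbrakk>a \<in> carrier A; b \<in> carrier A; m \<in> carrier M\<rbrakk> \<Longrightarrow>
      ract M (lact M a m) b = lact M a (ract M m b)"

locale left_comodule = module complex_alg M for A :: "'a hopf_alg" and M :: "('a, 'm) bicov" +
  assumes lcoact_linear: "linear_map M (tensor A M) (lcoact M)"
    and lcoact_coassoc: "m \<in> carrier M \<Longrightarrow>
      tensor_assoc A A M (tensor_map (tensor A A) M (comult A) id (lcoact M m)) =
      tensor_map A (tensor A M) id (lcoact M) (lcoact M m)"
    and lcoact_counit: "m \<in> carrier M \<Longrightarrow>
      lift M (\<lambda>a n. counit A a \<odot>\<^bsub>M\<^esub> n) (lcoact M m) = m"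

locale right_comodule = module complex_alg M for A :: "'a hopf_alg" and M :: "('a, 'm) bicov" +
  assumes rcoact_linear: "linear_map M (tensor M A) (rcoact M)"
    and rcoact_coassoc: "m \<in> carrier M \<Longrightarrow>
      tensor_assoc M A A (tensor_map (tensor M A) A (rcoact M) id (rcoact M m)) =
      tensor_map M (tensor A A) id (comult A) (rcoact M m)"
    and rcoact_counit: "m \<in> carrier M \<Longrightarrow>
      lift M (\<lambda>n a. counit A a \<odot>\<^bsub>M\<^esub> n) (rcoact M m) = m"

locale bicovariant_bimodule = bimodule A M + left_comodule A M + right_comodule A M
  for A :: "'a hopf_alg" and M :: "('a, 'm) bicov" +
  assumes bicomodule: "m \<in> carrier M \<Longrightarrow>
      tensor_map A (tensor M A) id (rcoact M) (lcoact M m) =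
      tensor_assoc A M A (tensor_map (tensor A M) A (lcoact M) id (rcoact M m))"
    and lcoact_lact: "\<lbrakk>a \<in> carrier A; m \<in> carrier M\<rbrakk> \<Longrightarrow>
      lcoact M (lact M a m) = tensor_mult A M (mult A) (lact M) (comult A a) (lcoact M m)"
    and lcoact_ract: "\<lbrakk>a \<in> carrier A; m \<in> carrier M\<rbrakk> \<Longrightarrow>
      lcoact M (ract M m a) = tensor_mult A M (mult A) (ract M) (lcoact M m) (comult A a)"
    and rcoact_lact: "\<lbrakk>a \<in> carrier A; m \<in> carrier M\<rbrakk> \<Longrightarrow>
      rcoact M (lact M a m) = tensor_mult M A (lact M) (mult A) (comult A a) (rcoact M m)"
    and rcoact_ract: "\<lbrakk>a \<in> carrier A; m \<in> carrier M\<rbrakk> \<Longrightarrow>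
      rcoact M (ract M m a) = tensor_mult M A (ract M) (mult A) (rcoact M m) (comult A a)"

definition left_invariants :: "'a hopf_alg \<Rightarrow> ('a, 'm) bicov \<Rightarrow> 'm set" where
  "left_invariants A M = {m \<in> carrier M. lcoact M m = tens A M \<one>\<^bsub>A\<^esub> m}"

definition right_invariants :: "'a hopf_alg \<Rightarrow> ('a, 'm) bicov \<Rightarrow> 'm set" where
  "right_invariants A M = {m \<in> carrier M. rcoact M m = tens M A m \<one>\<^bsub>A\<^esub>}"

definition finite_bicovariant :: "'a hopf_alg \<Rightarrow> ('a, 'm) bicov \<Rightarrow> bool" where
  "finite_bicovariant A M \<longleftrightarrow>
     (\<exists>B. finite B \<and> B \<subseteq> left_invariants A M \<and> left_invariants A M \<subseteq> linear_span M B)"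

definition bimodule_map ::
  "'a hopf_alg \<Rightarrow> ('a, 'm) bicov \<Rightarrow> ('a, 'n) bicov \<Rightarrow> ('m \<Rightarrow> 'n) \<Rightarrow> bool" where
  "bimodule_map A M N f \<longleftrightarrow> linear_map M N f \<and>
     (\<forall>a\<in>carrier A. \<forall>m\<in>carrier M.
        f (lact M a m) = lact N a (f m) \<and> f (ract M m a) = ract N (f m) a)"


section \<open>The tensor product over \<open>A\<close>\<close>

definition balancing_relations ::
  "'a hopf_alg \<Rightarrow> ('a, 'm) bicov \<Rightarrow> ('a, 'n) bicov \<Rightarrow> ('m \<times> 'n \<Rightarrow>\<^sub>0 complex) set" where
  "balancing_relations A M N =
     {pair_of (ract M m a) n - pair_of m (lact N a n) | m a n.
        m \<in> carrier M \<and> a \<in> carrier A \<and> n \<in> carrier N}"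

definition tens_over ::
  "'a hopf_alg \<Rightarrow> ('a, 'm) bicov \<Rightarrow> ('a, 'n) bicov \<Rightarrow> 'm \<Rightarrow> 'n \<Rightarrow> ('m, 'n) tens" where
  "tens_over A M N = tens_by (balancing_relations A M N) M N"

definition tensor_over ::
  "'a hopf_alg \<Rightarrow> ('a, 'm) bicov \<Rightarrow> ('a, 'n) bicov \<Rightarrow> ('a, ('m, 'n) tens) bicov" where
  "tensor_over A M N =
     (let T = tensor_by (balancing_relations A M N) M N in
      \<lparr>carrier = carrier T, mult = undefined, one = undefined, zero = \<zero>\<^bsub>T\<^esub>,
       add = (\<oplus>\<^bsub>T\<^esub>), smult = (\<odot>\<^bsub>T\<^esub>),
       lact = (\<lambda>a. lift T (\<lambda>m n. tens_over A M N (lact M a m) n)),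
       ract = (\<lambda>t a. lift T (\<lambda>m n. tens_over A M N m (ract N n a)) t),
       lcoact = lift (tensor A T)
         (\<lambda>m n. tensor_mult A T (mult A) (tens_over A M N) (lcoact M m) (lcoact N n)),
       rcoact = lift (tensor T A)
         (\<lambda>m n. tensor_mult T A (tens_over A M N) (mult A) (rcoact M m) (rcoact N n))\<rparr>)"


section \<open>Braiding and pseudo-Riemannian metrics\<close>

text \<open>The braiding is made unique as a HOL function by being \<open>undefined\<close> off the carrier.\<close>

definition braiding ::
  "'a hopf_alg \<Rightarrow> ('a, 'e) bicov \<Rightarrow> ('e, 'e) tens \<Rightarrow> ('e, 'e) tens" where
  "braiding A E =
     (THE \<sigma>. \<sigma> \<in> extensional (carrier (tensor_over A E E)) \<and>
        bimodule_map A (tensor_over A E E) (tensor_over A E E) \<sigma> \<and>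
        (\<forall>\<omega>\<in>left_invariants A E. \<forall>\<eta>\<in>right_invariants A E.
           \<sigma> (tens_over A E E \<omega> \<eta>) = tens_over A E E \<eta> \<omega>))"

locale pseudo_Riemannian_metric =
  fixes A :: "'a hopf_alg" and E :: "('a, 'e) bicov" and g :: "('e, 'e) tens \<Rightarrow> 'a"
  assumes metric_linear: "linear_map (tensor_over A E E) A g"
    and metric_right_linear: "\<lbrakk>t \<in> carrier (tensor_over A E E); a \<in> carrier A\<rbrakk> \<Longrightarrow>
      g (ract (tensor_over A E E) t a) = g t \<otimes>\<^bsub>A\<^esub> a"
    and metric_symmetric: "t \<in> carrier (tensor_over A E E) \<Longrightarrow> g (braiding A E t) = g t"
    and metric_nondegenerate: "\<lbrakk>\<rho> \<in> carrier E;
      \<And>\<nu>. \<nu> \<in> carrier E \<Longrightarrow> g (tens_over A E E \<rho> \<nu>) = \<zero>\<^bsub>A\<^esub>\<rbrakk> \<Longrightarrow> \<rho> = \<zero>\<^bsub>E\<^esub>"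

text \<open>The identifications of \<open>A \<otimes> \<complex>\<close> and \<open>\<complex> \<otimes> A\<close> with \<open>A\<close> are built into the invariance conditions.\<close>

definition left_invariant ::
  "'a hopf_alg \<Rightarrow> ('a, 'e) bicov \<Rightarrow> (('e, 'e) tens \<Rightarrow> 'a) \<Rightarrow> bool" where
  "left_invariant A E g \<longleftrightarrow>
     (\<forall>\<rho>\<in>carrier E. \<forall>\<nu>\<in>carrier E.
        lift A (\<lambda>a t. counit A (g t) \<odot>\<^bsub>A\<^esub> a)
          (lcoact (tensor_over A E E) (tens_over A E E \<rho> \<nu>)) = g (tens_over A E E \<rho> \<nu>))"

definition right_invariant ::
  "'a hopf_alg \<Rightarrow> ('a, 'e) bicov \<Rightarrow> (('e, 'e) tens \<Rightarrow> 'a) \<Rightarrow> bool" where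
  "right_invariant A E g \<longleftrightarrow>
     (\<forall>\<rho>\<in>carrier E. \<forall>\<nu>\<in>carrier E.
        lift A (\<lambda>t a. counit A (g t) \<odot>\<^bsub>A\<^esub> a)
          (rcoact (tensor_over A E E) (tens_over A E E \<rho> \<nu>)) = g (tens_over A E E \<rho> \<nu>))"

end

theory Submission
  imports Defs
begin

text \<open>
  For any left comodule \<open>T\<close> with coaction \<open>\<delta>\<close> and any linear \<open>g : T \<rightarrow> A\<close>, if \<open>g = (id \<otimes> \<epsilon>g) \<delta>\<close> then
  coassociativity gives \<open>\<Delta> g = (\<Delta> \<otimes> \<epsilon>g) \<delta> = (id \<otimes> id \<otimes> \<epsilon>g) (id \<otimes> \<delta>) \<delta> = (id \<otimes> g) \<delta>\<close>; conversely,
  applying \<open>id \<otimes> \<epsilon>\<close> to \<open>(id \<otimes> g) \<delta> = \<Delta> g\<close> recovers \<open>g = (id \<otimes> \<epsilon>g) \<delta>\<close>.  The right-handed statement is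
  symmetric.  It remains to see that the formulas for the coactions on \<open>E \<otimes>\<^sub>A E\<close> respect the balancing
  relations and are coassociative.  Coassociativity holds because the componentwise product
  \<open>(A \<otimes> E) \<times> (A \<otimes> E) \<rightarrow> A \<otimes> (E \<otimes>\<^sub>A E)\<close> is compatible with both \<open>\<Delta> \<otimes> id\<close> and \<open>id \<otimes> \<delta>\<close>.
\<close>

section \<open>Complex vector spaces as modules\<close>

lemma complex_alg_simps [simp]:
  "carrier complex_alg = UNIV" "\<zero>\<^bsub>complex_alg\<^esub> = 0" "\<one>\<^bsub>complex_alg\<^esub> = 1"
  "x \<oplus>\<^bsub>complex_alg\<^esub> y = x + y" "x \<otimes>\<^bsub>complex_alg\<^esub> y = x * y"
  "x \<odot>\<^bsub>complex_alg\<^esub> y = x * y"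
  by (simp_all add: complex_alg_def)

lemma cring_complex_alg: "cring complex_alg"
proof (rule cringI)
  show "abelian_group complex_alg"
    by (rule abelian_groupI) (auto simp: algebra_simps intro: exI[of _ "- _"])
  show "Group.comm_monoid complex_alg"
    by (rule comm_monoidI) auto
qed (auto simp: algebra_simps)

abbreviation complex_space :: "(complex, 'v, 'x) module_scheme \<Rightarrow> bool" where
  "complex_space V \<equiv> module complex_alg V"

lemma complex_spaceI:
  assumes "abelian_group V"
    and "\<And>c x. x \<in> carrier V \<Longrightarrow> c \<odot>\<^bsub>V\<^esub> x \<in> carrier V"
    and "\<And>c d x. x \<in> carrier V \<Longrightarrow> (c + d) \<odot>\<^bsub>V\<^esub> x = c \<odot>\<^bsub>V\<^esub> x \<oplus>\<^bsub>V\<^esub> d \<odot>\<^bsub>V\<^esub> x"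
    and "\<And>c x y. x \<in> carrier V \<Longrightarrow> y \<in> carrier V \<Longrightarrow>
      c \<odot>\<^bsub>V\<^esub> (x \<oplus>\<^bsub>V\<^esub> y) = c \<odot>\<^bsub>V\<^esub> x \<oplus>\<^bsub>V\<^esub> c \<odot>\<^bsub>V\<^esub> y"
    and "\<And>c d x. x \<in> carrier V \<Longrightarrow> (c * d) \<odot>\<^bsub>V\<^esub> x = c \<odot>\<^bsub>V\<^esub> (d \<odot>\<^bsub>V\<^esub> x)"
    and "\<And>x. x \<in> carrier V \<Longrightarrow> 1 \<odot>\<^bsub>V\<^esub> x = x"
  shows "complex_space V"
  using assms by (intro moduleI cring_complex_alg) auto

text \<open>This fact and the next three take the vector space as an explicit premise and carry no
  side condition on scalars. They can thus be instantiated with \<open>OF\<close> when many spaces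
  occur at once.\<close>

lemma smult_closed': "complex_space V \<Longrightarrow> x \<in> carrier V \<Longrightarrow> c \<odot>\<^bsub>V\<^esub> x \<in> carrier V"
  by (rule module.smult_closed) auto

lemma add_closed': "complex_space V \<Longrightarrow> x \<in> carrier V \<Longrightarrow> y \<in> carrier V \<Longrightarrow> x \<oplus>\<^bsub>V\<^esub> y \<in> carrier V"
  by (simp add: module_def abelian_group_def abelian_monoid.a_closed)

lemma zero_closed': "complex_space V \<Longrightarrow> \<zero>\<^bsub>V\<^esub> \<in> carrier V"
  by (simp add: module_def abelian_group_def abelian_monoid.zero_closed)

lemma smult_zero': "complex_space V \<Longrightarrow> x \<in> carrier V \<Longrightarrow> 0 \<odot>\<^bsub>V\<^esub> x = \<zero>\<^bsub>V\<^esub>"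
  using module.smult_l_null[of complex_alg V x] by simp

section \<open>Linear and bilinear maps\<close>

lemma linear_mapI:
  assumes "\<And>x. x \<in> carrier M \<Longrightarrow> f x \<in> carrier N"
    and "\<And>x y. \<lbrakk>x \<in> carrier M; y \<in> carrier M\<rbrakk> \<Longrightarrow> f (x \<oplus>\<^bsub>M\<^esub> y) = f x \<oplus>\<^bsub>N\<^esub> f y"
    and "\<And>c x. x \<in> carrier M \<Longrightarrow> f (c \<odot>\<^bsub>M\<^esub> x) = c \<odot>\<^bsub>N\<^esub> f x"
  shows "linear_map M N f"
  using assms by (auto simp: linear_map_def)

lemma linear_map_closed: "\<lbrakk>linear_map M N f; x \<in> carrier M\<rbrakk> \<Longrightarrow> f x \<in> carrier N"
  and linear_map_add: "\<lbrakk>linear_map M N f; x \<in> carrier M; y \<in> carrier M\<rbrakk> \<Longrightarrow>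
    f (x \<oplus>\<^bsub>M\<^esub> y) = f x \<oplus>\<^bsub>N\<^esub> f y"
  and linear_map_smult: "\<lbrakk>linear_map M N f; x \<in> carrier M\<rbrakk> \<Longrightarrow> f (c \<odot>\<^bsub>M\<^esub> x) = c \<odot>\<^bsub>N\<^esub> f x"
  by (auto simp: linear_map_def)

lemma linear_map_zero:
  assumes "complex_space M" "complex_space N" "linear_map M N f"
  shows "f \<zero>\<^bsub>M\<^esub> = \<zero>\<^bsub>N\<^esub>"
  using linear_map_smult[OF assms(3) zero_closed'[OF assms(1)], of 0]
    linear_map_closed[OF assms(3) zero_closed'[OF assms(1)]]
  by (simp add: smult_zero' assms zero_closed')

text \<open>Submodules have to be closed under negation, whereas \<open>linear_map\<close> only
  speaks of sums and scalar multiples; scaling by \<open>-1\<close> connects the two.\<close>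

lemma minus_eq_smult:
  assumes "complex_space V" "x \<in> carrier V"
  shows "\<ominus>\<^bsub>V\<^esub> x = (-1) \<odot>\<^bsub>V\<^esub> x"
proof -
  interpret V: module complex_alg V by fact
  have "(-1) \<odot>\<^bsub>V\<^esub> x \<oplus>\<^bsub>V\<^esub> x = \<zero>\<^bsub>V\<^esub>"
    using V.smult_l_distr[of "-1" 1 x] V.smult_l_null[of x] V.smult_one[of x] assms(2) by simp
  then show ?thesis
    using V.minus_equality[of "(-1) \<odot>\<^bsub>V\<^esub> x" x] assms(2) V.smult_closed[of "-1" x] by simp
qed

text \<open>Serves to extend the vanishing of a map from generating relations to everything that
  they span.\<close>

lemma linear_map_kernel:
  assumes M: "complex_space M" and N: "complex_space N" and f: "linear_map M N f"
  shows "submodule {x \<in> carrier M. f x = \<zero>\<^bsub>N\<^esub>} complex_alg M"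
proof -
  interpret M: module complex_alg M by fact
  interpret N: module complex_alg N by fact
  have s: "c \<odot>\<^bsub>M\<^esub> a \<in> {x \<in> carrier M. f x = \<zero>\<^bsub>N\<^esub>}"
    if "a \<in> {x \<in> carrier M. f x = \<zero>\<^bsub>N\<^esub>}" for a c
    using that smult_closed'[OF M] N.smult_r_null[of c]
    by (auto simp: linear_map_smult[OF f])
  show ?thesis
  proof (rule M.submoduleI)
    show "\<zero>\<^bsub>M\<^esub> \<in> {x \<in> carrier M. f x = \<zero>\<^bsub>N\<^esub>}"
      using linear_map_zero[OF M N f] by simp
    show "\<ominus>\<^bsub>M\<^esub> a \<in> {x \<in> carrier M. f x = \<zero>\<^bsub>N\<^esub>}" if "a \<in> {x \<in> carrier M. f x = \<zero>\<^bsub>N\<^esub>}" for a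
      using s[OF that, of "-1"] that minus_eq_smult[OF M, of a] by simp
  qed (use s in \<open>auto simp: linear_map_add[OF f]\<close>)
qed

lemma linear_map_comp:
  "\<lbrakk>linear_map M N f; linear_map N P h\<rbrakk> \<Longrightarrow> linear_map M P (\<lambda>x. h (f x))"
  by (simp add: linear_map_def Pi_iff)

lemma linear_map_id: "linear_map M M (\<lambda>x. x)"
  by (auto simp: linear_map_def)

lemma linear_map_id': "linear_map M M id"
  by (simp add: linear_map_def)

lemma linear_map_cong:
  "\<lbrakk>complex_space M; \<And>x. x \<in> carrier M \<Longrightarrow> f x = h x; linear_map M N h\<rbrakk> \<Longrightarrow> linear_map M N f"
  by (simp add: linear_map_def Pi_def add_closed' smult_closed')

lemma linear_map_sum:
  assumes N: "complex_space N" and f: "linear_map M N f" and h: "linear_map M N h"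
  shows "linear_map M N (\<lambda>x. f x \<oplus>\<^bsub>N\<^esub> h x)"
proof -
  interpret N: module complex_alg N by fact
  note [simp] = linear_map_closed[OF f] linear_map_closed[OF h]
  show ?thesis
    by (rule linear_mapI)
      (auto simp: linear_map_add[OF f] linear_map_add[OF h] linear_map_smult[OF f]
        linear_map_smult[OF h] N.smult_r_distr N.a_ac)
qed

lemma linear_map_scaled:
  assumes N: "complex_space N" and f: "linear_map M N f"
  shows "linear_map M N (\<lambda>x. c \<odot>\<^bsub>N\<^esub> f x)"
proof -
  interpret N: module complex_alg N by fact
  have "c \<odot>\<^bsub>N\<^esub> (d \<odot>\<^bsub>N\<^esub> y) = d \<odot>\<^bsub>N\<^esub> (c \<odot>\<^bsub>N\<^esub> y)" if "y \<in> carrier N" for d y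
    using N.smult_assoc1[of c d y] N.smult_assoc1[of d c y] that by (simp add: mult.commute)
  moreover note [simp] = linear_map_closed[OF f]
  ultimately show ?thesis
    by (intro linear_mapI)
      (auto simp: linear_map_add[OF f] linear_map_smult[OF f] N.smult_r_distr smult_closed'[OF N])
qed

lemma bilinear_mapI:
  assumes "\<And>m. m \<in> carrier M \<Longrightarrow> linear_map N P (\<lambda>n. \<beta> m n)"
    and "\<And>n. n \<in> carrier N \<Longrightarrow> linear_map M P (\<lambda>m. \<beta> m n)"
  shows "bilinear_map M N P \<beta>"
  using assms by (simp add: bilinear_map_def)

lemma bilinear_map_left: "\<lbrakk>bilinear_map M N P \<beta>; n \<in> carrier N\<rbrakk> \<Longrightarrow> linear_map M P (\<lambda>m. \<beta> m n)"
  and bilinear_map_right: "\<lbrakk>bilinear_map M N P \<beta>; m \<in> carrier M\<rbrakk> \<Longrightarrow> linear_map N P (\<lambda>n. \<beta> m n)"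
  by (simp_all add: bilinear_map_def)

lemma bilinear_map_closed:
  "\<lbrakk>bilinear_map M N P \<beta>; m \<in> carrier M; n \<in> carrier N\<rbrakk> \<Longrightarrow> \<beta> m n \<in> carrier P"
  by (rule linear_map_closed[OF bilinear_map_right])

lemma bilinear_map_swap: "bilinear_map M N P \<beta> \<Longrightarrow> bilinear_map N M P (\<lambda>n m. \<beta> m n)"
  by (simp add: bilinear_map_def)

lemma bilinear_map_comp:
  assumes "bilinear_map M N P \<beta>" "linear_map M' M f" "linear_map N' N h" "linear_map P P' k"
  shows "bilinear_map M' N' P' (\<lambda>x y. k (\<beta> (f x) (h y)))"
proof (rule bilinear_mapI)
  fix m assume "m \<in> carrier M'"
  then have "f m \<in> carrier M" by (rule linear_map_closed[OF assms(2)])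
  then show "linear_map N' P' (\<lambda>n. k (\<beta> (f m) (h n)))"
    by (intro linear_map_comp[OF linear_map_comp[OF assms(3)] assms(4)]
        bilinear_map_right[OF assms(1)])
next
  fix n assume "n \<in> carrier N'"
  then have "h n \<in> carrier N" by (rule linear_map_closed[OF assms(3)])
  then show "linear_map M' P' (\<lambda>m. k (\<beta> (f m) (h n)))"
    by (intro linear_map_comp[OF linear_map_comp[OF assms(2)] assms(4)]
        bilinear_map_left[OF assms(1)])
qed

lemmas bilinear_map_comp_args = bilinear_map_comp[OF _ _ _ linear_map_id]
lemmas bilinear_map_comp_result = bilinear_map_comp[OF _ linear_map_id linear_map_id]

lemma bilinear_map_smult:
  assumes "complex_space V"
  shows "bilinear_map complex_alg V V (smult V)"
proof -
  interpret V: module complex_alg V by fact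
  show ?thesis
    using V.smult_l_distr V.smult_assoc1 linear_map_scaled[OF assms linear_map_id]
    by (intro bilinear_mapI[OF _ linear_mapI]) (simp_all add: smult_closed'[OF assms])
qed

section \<open>Free spaces, spans and quotients\<close>

lemma free_space_simps [simp]:
  "carrier (free_space S) = {x. Poly_Mapping.keys x \<subseteq> S}" "\<zero>\<^bsub>free_space S\<^esub> = 0"
  "x \<oplus>\<^bsub>free_space S\<^esub> y = x + y" "c \<odot>\<^bsub>free_space S\<^esub> x = Poly_Mapping.map ((*) c) x"
  by (simp_all add: free_space_def)

lemma lookup_map_times [simp]:
  "Poly_Mapping.lookup (Poly_Mapping.map ((*) c) x) k = c * Poly_Mapping.lookup x k" for c :: complex
  by (simp add: Poly_Mapping.map.rep_eq when_def)

lemma keys_map_times: "Poly_Mapping.keys (Poly_Mapping.map ((*) c) x) \<subseteq> Poly_Mapping.keys x"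
  for c :: complex
  by (auto simp: in_keys_iff)

lemma complex_space_free_space: "complex_space (free_space S)"
proof (rule complex_spaceI)
  show "abelian_group (free_space S)"
  proof (rule abelian_groupI)
    fix x assume "x \<in> carrier (free_space S)"
    then show "\<exists>y\<in>carrier (free_space S). y \<oplus>\<^bsub>free_space S\<^esub> x = \<zero>\<^bsub>free_space S\<^esub>"
      by (intro bexI[of _ "- x"]) auto
  qed (use Poly_Mapping.keys_add in \<open>fastforce simp: add_ac\<close>)+
  show "c \<odot>\<^bsub>free_space S\<^esub> x \<in> carrier (free_space S)" if "x \<in> carrier (free_space S)" for c x
    using that keys_map_times[of c x] by auto
qed (auto intro!: poly_mapping_eqI simp: lookup_add algebra_simps)

lemma free_space_induct [consumes 1, case_names zero add]:
  assumes "x \<in> carrier (free_space S)"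
    and "P 0"
    and "\<And>s c x. \<lbrakk>s \<in> S; x \<in> carrier (free_space S); P x\<rbrakk> \<Longrightarrow> P (Poly_Mapping.single s c + x)"
  shows "P x"
  using assms(1)
proof (induction x rule: Poly_Mapping.update_induct)
  case const
  then show ?case by (simp add: assms)
next
  case (update f a b)
  have k: "Poly_Mapping.keys (Poly_Mapping.update a b f) = insert a (Poly_Mapping.keys f)"
    using update(2) by (auto simp: in_keys_iff lookup_update split: if_splits)
  \<comment> \<open>Since \<open>a\<close> is not yet a key of \<open>f\<close>, overwriting its
    coefficient is the same as adding a monomial.\<close>
  have "Poly_Mapping.update a b f = Poly_Mapping.single a b + f"
    using update(1) by (intro poly_mapping_eqI) (auto simp: lookup_update lookup_add lookup_single in_keys_iff when_def)
  then show ?case using assms(3)[of a f b] update k by simp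
qed

section \<open>Linear spans\<close>

lemma submodule_linear_span:
  assumes V: "complex_space V" and S: "S \<subseteq> carrier V"
  shows "submodule (linear_span V S) complex_alg V"
proof -
  interpret V: module complex_alg V by fact
  let ?F = "{W. submodule W complex_alg V \<and> S \<subseteq> W}"
  have "carrier V \<in> ?F" using V.carrier_is_submodule S by simp
  moreover have "\<zero>\<^bsub>V\<^esub> \<in> W" if "W \<in> ?F" for W
    using that subgroup.one_closed[OF submodule.axioms(1), of W complex_alg V] by simp
  ultimately have "submodule (\<Inter>?F) complex_alg V"
    using V.submoduleE(3-5) by (intro V.submoduleI) auto
  then show ?thesis by (simp add: linear_span_def hull_def)
qed

text \<open>The kernel is one of the submodules containing \<open>S\<close>, and the hull is the
  smallest of them.\<close>

lemma span_subset_kernel: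
  assumes "complex_space V" "complex_space P" "linear_map V P f"
    and "S \<subseteq> carrier V" "\<And>x. x \<in> S \<Longrightarrow> f x = \<zero>\<^bsub>P\<^esub>" "x \<in> linear_span V S"
  shows "f x = \<zero>\<^bsub>P\<^esub>"
proof -
  have "linear_span V S \<subseteq> {x \<in> carrier V. f x = \<zero>\<^bsub>P\<^esub>}"
    unfolding linear_span_def
    by (rule hull_minimal) (use assms linear_map_kernel in auto)
  then show ?thesis using assms by blast
qed

section \<open>Quotient spaces, computed on representatives\<close>

lemma quotient_space_simps:
  "carrier (quotient_space V W) = a_rcosets\<^bsub>V\<^esub> W" "\<zero>\<^bsub>quotient_space V W\<^esub> = W"
  "x \<oplus>\<^bsub>quotient_space V W\<^esub> y = x <+>\<^bsub>V\<^esub> y"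
  "c \<odot>\<^bsub>quotient_space V W\<^esub> X = (\<Union>x\<in>X. W +>\<^bsub>V\<^esub> (c \<odot>\<^bsub>V\<^esub> x))"
  by (simp_all add: quotient_space_def)

locale subspace_of =
  fixes V :: "(complex, 'v, 'x) module_scheme" and W
  assumes space: "complex_space V" and sub: "submodule W complex_alg V"
begin

interpretation V: module complex_alg V by (rule space)

lemma abelian_subgroup: "abelian_subgroup W V"
  by (intro abelian_subgroupI3 additive_subgroup.intro submodule.axioms(1)[OF sub])
    (rule V.abelian_group_axioms)

interpretation W: abelian_subgroup W V by (rule abelian_subgroup)

lemma carrier_quotient: "carrier (quotient_space V W) = (\<lambda>v. W +>\<^bsub>V\<^esub> v) ` carrier V"
  by (auto simp: quotient_space_simps A_RCOSETS_def')

lemma add_quotient: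
  "\<lbrakk>u \<in> carrier V; v \<in> carrier V\<rbrakk> \<Longrightarrow>
    (W +>\<^bsub>V\<^esub> u) \<oplus>\<^bsub>quotient_space V W\<^esub> (W +>\<^bsub>V\<^esub> v) = W +>\<^bsub>V\<^esub> (u \<oplus>\<^bsub>V\<^esub> v)"
  by (simp add: quotient_space_simps W.a_rcos_sum)

lemma zero_quotient: "\<zero>\<^bsub>quotient_space V W\<^esub> = W +>\<^bsub>V\<^esub> \<zero>\<^bsub>V\<^esub>"
  using W.a_subset by (simp add: quotient_space_simps)

lemma coset_eqI:
  assumes "u \<in> carrier V" "v \<in> carrier V" "u \<ominus>\<^bsub>V\<^esub> v \<in> W"
  shows "W +>\<^bsub>V\<^esub> u = W +>\<^bsub>V\<^esub> v"
  using assms W.a_repr_independence'[OF W.a_rcos_module_rev, of v u] by (simp add: a_minus_def)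

text \<open>The scalar multiple in the quotient is a union over all representatives of a coset. Two
  representatives differ by some \<open>w\<close> in \<open>W\<close>, and \<open>c\<close> times
  \<open>w\<close> stays in \<open>W\<close>, so every member of the union is the same
  coset.\<close>

lemma smult_quotient:
  assumes v: "v \<in> carrier V"
  shows "c \<odot>\<^bsub>quotient_space V W\<^esub> (W +>\<^bsub>V\<^esub> v) = W +>\<^bsub>V\<^esub> (c \<odot>\<^bsub>V\<^esub> v)"
proof -
  have "W +>\<^bsub>V\<^esub> (c \<odot>\<^bsub>V\<^esub> x) = W +>\<^bsub>V\<^esub> (c \<odot>\<^bsub>V\<^esub> v)" if x: "x \<in> W +>\<^bsub>V\<^esub> v" for x
  proof -
    obtain w where w: "w \<in> W" "x = w \<oplus>\<^bsub>V\<^esub> v" using x by (auto simp: a_r_coset_def')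
    then have wc: "w \<in> carrier V" using W.a_subset by blast
    have cw: "c \<odot>\<^bsub>V\<^esub> w \<in> W" using V.submoduleE(4)[OF sub] w by simp
    have "c \<odot>\<^bsub>V\<^esub> x = c \<odot>\<^bsub>V\<^esub> w \<oplus>\<^bsub>V\<^esub> c \<odot>\<^bsub>V\<^esub> v"
      using w wc v by (simp add: V.smult_r_distr)
    then have "c \<odot>\<^bsub>V\<^esub> x \<in> W +>\<^bsub>V\<^esub> (c \<odot>\<^bsub>V\<^esub> v)" using cw by (auto simp: a_r_coset_def')
    then show ?thesis
      using W.a_repr_independence'[of "c \<odot>\<^bsub>V\<^esub> x" "c \<odot>\<^bsub>V\<^esub> v"] smult_closed'[OF space v] by simp
  qed
  moreover have "v \<in> W +>\<^bsub>V\<^esub> v" using v W.a_rcos_self by simp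
  ultimately show ?thesis unfolding quotient_space_simps by blast
qed

lemma complex_space_quotient: "complex_space (quotient_space V W)"
proof (rule complex_spaceI)
  show "abelian_group (quotient_space V W)"
  proof (rule abelian_groupI)
    show "\<zero>\<^bsub>quotient_space V W\<^esub> \<in> carrier (quotient_space V W)"
      by (simp add: zero_quotient carrier_quotient)
    show "\<exists>y\<in>carrier (quotient_space V W). y \<oplus>\<^bsub>quotient_space V W\<^esub> x = \<zero>\<^bsub>quotient_space V W\<^esub>"
      if x: "x \<in> carrier (quotient_space V W)" for x
    proof -
      obtain v where v: "v \<in> carrier V" "x = W +>\<^bsub>V\<^esub> v" using x by (auto simp: carrier_quotient)
      then have "(W +>\<^bsub>V\<^esub> \<ominus>\<^bsub>V\<^esub> v) \<oplus>\<^bsub>quotient_space V W\<^esub> x = \<zero>\<^bsub>quotient_space V W\<^esub>"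
        by (simp add: zero_quotient add_quotient V.l_neg)
      then show ?thesis using v by (auto simp: carrier_quotient)
    qed
  qed (auto simp: zero_quotient carrier_quotient add_quotient V.a_ac)
  show "c \<odot>\<^bsub>quotient_space V W\<^esub> x \<in> carrier (quotient_space V W)" if "x \<in> carrier (quotient_space V W)" for c x
    using that smult_closed'[OF space] by (auto simp: carrier_quotient smult_quotient)
  show "(c + d) \<odot>\<^bsub>quotient_space V W\<^esub> x = c \<odot>\<^bsub>quotient_space V W\<^esub> x \<oplus>\<^bsub>quotient_space V W\<^esub> d \<odot>\<^bsub>quotient_space V W\<^esub> x"
    if "x \<in> carrier (quotient_space V W)" for c d x
    using that smult_closed'[OF space] V.smult_l_distr
    by (auto simp: carrier_quotient smult_quotient add_quotient)
  show "c \<odot>\<^bsub>quotient_space V W\<^esub> (x \<oplus>\<^bsub>quotient_space V W\<^esub> y) =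
      c \<odot>\<^bsub>quotient_space V W\<^esub> x \<oplus>\<^bsub>quotient_space V W\<^esub> c \<odot>\<^bsub>quotient_space V W\<^esub> y"
    if "x \<in> carrier (quotient_space V W)" "y \<in> carrier (quotient_space V W)" for c x y
    using that smult_closed'[OF space] V.smult_r_distr
    by (auto simp: carrier_quotient smult_quotient add_quotient)
  show "(c * d) \<odot>\<^bsub>quotient_space V W\<^esub> x = c \<odot>\<^bsub>quotient_space V W\<^esub> (d \<odot>\<^bsub>quotient_space V W\<^esub> x)"
    if "x \<in> carrier (quotient_space V W)" for c d x
    using that smult_closed'[OF space] V.smult_assoc1
    by (auto simp: carrier_quotient smult_quotient)
  show "1 \<odot>\<^bsub>quotient_space V W\<^esub> x = x" if "x \<in> carrier (quotient_space V W)" for x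
    using that V.smult_one by (auto simp: carrier_quotient smult_quotient)
qed

end

section \<open>Differences and linear evaluation of formal combinations\<close>

lemma free_space_minus:
  assumes "x \<in> carrier (free_space S)" "y \<in> carrier (free_space S)"
  shows "x \<ominus>\<^bsub>free_space S\<^esub> y = x - y"
proof -
  interpret F: module complex_alg "free_space S" by (rule complex_space_free_space)
  have "\<ominus>\<^bsub>free_space S\<^esub> y = - y"
    by (rule F.minus_equality) (use assms in auto)
  then show ?thesis by (simp add: a_minus_def)
qed

lemma free_space_diff_closed:
  "\<lbrakk>x \<in> carrier (free_space S); y \<in> carrier (free_space S)\<rbrakk> \<Longrightarrow> x - y \<in> carrier (free_space S)"
  using keys_diff[of x y] by auto

text \<open>The defining relations of a tensor product are differences of formal combinations, while
  \<open>linear_map\<close> only provides sums. Writing \<open>x\<close> as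
  \<open>(x - y) + y\<close> bridges this.\<close>

lemma linear_map_free_diff:
  assumes "complex_space P" "linear_map (free_space S) P f"
    and "x \<in> carrier (free_space S)" "y \<in> carrier (free_space S)"
  shows "f (x - y) = f x \<ominus>\<^bsub>P\<^esub> f y"
proof -
  interpret P: module complex_alg P by fact
  have "f x = f (x - y) \<oplus>\<^bsub>P\<^esub> f y"
    using linear_map_add[OF assms(2) free_space_diff_closed[OF assms(3,4)] assms(4)] by simp
  then show ?thesis
    using linear_map_closed[OF assms(2)] free_space_diff_closed[OF assms(3,4)] assms(3,4)
    by (simp add: a_minus_def P.a_assoc P.r_neg del: free_space_simps)
qed

text \<open>Indices outside the support contribute \<open>0\<close> times a vector of
  \<open>P\<close>. Hence different formal combinations can be evaluated as sums over one common
  finite index set.\<close>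

lemma eval_formal_superset:
  assumes P: "complex_space P" and K: "finite K" "Poly_Mapping.keys x \<subseteq> K"
    and b: "\<And>p. p \<in> K \<Longrightarrow> \<beta> (fst p) (snd p) \<in> carrier P"
  shows "eval_formal P \<beta> x =
    (\<Oplus>\<^bsub>P\<^esub>p\<in>K. Poly_Mapping.lookup x p \<odot>\<^bsub>P\<^esub> \<beta> (fst p) (snd p))"
proof -
  interpret P: module complex_alg P by fact
  show ?thesis unfolding eval_formal_def
    using K b by (intro P.add.finprod_mono_neutral_cong_left)
      (auto simp: smult_closed'[OF P] smult_zero'[OF P] in_keys_iff)
qed

lemma linear_map_eval_formal:
  assumes P: "complex_space P" and b: "\<And>p. p \<in> S \<Longrightarrow> \<beta> (fst p) (snd p) \<in> carrier P"
  shows "linear_map (free_space S) P (eval_formal P \<beta>)"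
proof -
  interpret P: module complex_alg P by fact
  have scaled: "c \<odot>\<^bsub>P\<^esub> \<beta> (fst p) (snd p) \<in> carrier P" if "p \<in> S" for c p
    using smult_closed'[OF P b[OF that]] .
  show ?thesis
  proof (rule linear_mapI)
    fix x assume x: "x \<in> carrier (free_space S)"
    then show "eval_formal P \<beta> x \<in> carrier P"
      unfolding eval_formal_def by (intro P.finsum_closed) (auto intro!: scaled)
    fix y assume y: "y \<in> carrier (free_space S)"
    \<comment> \<open>Coefficients may cancel in \<open>x + y\<close>, so its support can be smaller
      than this union; all three evaluations are therefore summed over the union.\<close>
    let ?K = "Poly_Mapping.keys x \<union> Poly_Mapping.keys y"
    have K: "p \<in> S" if "p \<in> ?K" for p using x y that by auto
    have "eval_formal P \<beta> z = (\<Oplus>\<^bsub>P\<^esub>p\<in>?K. Poly_Mapping.lookup z p \<odot>\<^bsub>P\<^esub> \<beta> (fst p) (snd p))"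
      if "Poly_Mapping.keys z \<subseteq> ?K" for z
      using that by (intro eval_formal_superset[OF P]) (auto intro!: b K)
    moreover have "(\<Oplus>\<^bsub>P\<^esub>p\<in>?K. Poly_Mapping.lookup (x + y) p \<odot>\<^bsub>P\<^esub> \<beta> (fst p) (snd p)) =
        (\<Oplus>\<^bsub>P\<^esub>p\<in>?K. Poly_Mapping.lookup x p \<odot>\<^bsub>P\<^esub> \<beta> (fst p) (snd p) \<oplus>\<^bsub>P\<^esub>
          Poly_Mapping.lookup y p \<odot>\<^bsub>P\<^esub> \<beta> (fst p) (snd p))"
      using K P.smult_l_distr b
      by (intro P.finsum_cong') (auto simp: lookup_add intro!: scaled)
    moreover have "\<dots> = (\<Oplus>\<^bsub>P\<^esub>p\<in>?K. Poly_Mapping.lookup x p \<odot>\<^bsub>P\<^esub> \<beta> (fst p) (snd p)) \<oplus>\<^bsub>P\<^esub>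
        (\<Oplus>\<^bsub>P\<^esub>p\<in>?K. Poly_Mapping.lookup y p \<odot>\<^bsub>P\<^esub> \<beta> (fst p) (snd p))"
      using K by (intro P.finsum_addf) (auto intro!: scaled)
    ultimately show "eval_formal P \<beta> (x \<oplus>\<^bsub>free_space S\<^esub> y) = eval_formal P \<beta> x \<oplus>\<^bsub>P\<^esub> eval_formal P \<beta> y"
      using Poly_Mapping.keys_add[of x y] by simp
  next
    fix c x assume x: "x \<in> carrier (free_space S)"
    then have K: "p \<in> S" if "p \<in> Poly_Mapping.keys x" for p using that by auto
    have "eval_formal P \<beta> (Poly_Mapping.map ((*) c) x) =
        (\<Oplus>\<^bsub>P\<^esub>p\<in>Poly_Mapping.keys x. (c * Poly_Mapping.lookup x p) \<odot>\<^bsub>P\<^esub> \<beta> (fst p) (snd p))"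
      using eval_formal_superset[OF P, of "Poly_Mapping.keys x" "Poly_Mapping.map ((*) c) x" \<beta>]
        b K by (simp add: keys_map_times)
    also have "\<dots> = (\<Oplus>\<^bsub>P\<^esub>p\<in>Poly_Mapping.keys x.
        c \<odot>\<^bsub>P\<^esub> (Poly_Mapping.lookup x p \<odot>\<^bsub>P\<^esub> \<beta> (fst p) (snd p)))"
      using K P.smult_assoc1 b by (intro P.finsum_cong') (auto intro!: scaled smult_closed'[OF P])
    also have "\<dots> = c \<odot>\<^bsub>P\<^esub> eval_formal P \<beta> x"
      unfolding eval_formal_def using K by (intro P.finsum_smult_ldistr[symmetric]) (auto intro!: scaled)
    finally show "eval_formal P \<beta> (c \<odot>\<^bsub>free_space S\<^esub> x) = c \<odot>\<^bsub>P\<^esub> eval_formal P \<beta> x" by simp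
  qed
qed

lemma eval_formal_single:
  assumes P: "complex_space P" and b: "\<beta> m n \<in> carrier P"
  shows "eval_formal P \<beta> (Poly_Mapping.single (m, n) c) = c \<odot>\<^bsub>P\<^esub> \<beta> m n"
proof -
  interpret P: module complex_alg P by fact
  show ?thesis
    using eval_formal_superset[OF P, of "{(m, n)}" "Poly_Mapping.single (m, n) c" \<beta>] b
      smult_closed'[OF P b, of c]
    by simp
qed

section \<open>The universal property of tensor products\<close>

text \<open>The set \<open>X\<close> of extra relations is left arbitrary, so that the tensor
  product over the complex numbers and the one over \<open>A\<close> share one proof of the
  universal property.\<close>

locale tensor_relations =
  fixes X :: "('m \<times> 'n \<Rightarrow>\<^sub>0 complex) set" and M :: "(complex, 'm, 'x) module_scheme"
    and N :: "(complex, 'n, 'y) module_scheme"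
  assumes left: "complex_space M" and right: "complex_space N"
    and relations: "X \<subseteq> carrier (free_space (carrier M \<times> carrier N))"
begin

abbreviation "F \<equiv> free_space (carrier M \<times> carrier N)"
abbreviation "R \<equiv> relation_space X M N"
abbreviation "T \<equiv> tensor_by X M N"

lemma single_closed:
  "\<lbrakk>m \<in> carrier M; n \<in> carrier N\<rbrakk> \<Longrightarrow> Poly_Mapping.single (m, n) c \<in> carrier F"
  by auto

lemma relations_closed: "bilinear_relations M N \<union> X \<subseteq> carrier F"
proof -
  note closed = add_closed'[OF left] add_closed'[OF right] smult_closed'[OF left]
    smult_closed'[OF right]
  have "bilinear_relations M N \<subseteq> carrier F"
    unfolding bilinear_relations_def
    by (intro Un_least; clarify; intro free_space_diff_closed single_closed closed)
  then show ?thesis using relations by simp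
qed

sublocale Q: subspace_of F R
  by (rule subspace_of.intro, rule complex_space_free_space, unfold relation_space_def)
    (intro submodule_linear_span complex_space_free_space relations_closed)

lemma complex_space_tensor_by: "complex_space T"
  unfolding tensor_by_def by (rule Q.complex_space_quotient)

lemma tens_by_closed: "\<lbrakk>m \<in> carrier M; n \<in> carrier N\<rbrakk> \<Longrightarrow> tens_by X M N m n \<in> carrier T"
  unfolding tensor_by_def tens_by_def Q.carrier_quotient by (intro imageI single_closed)

text \<open>A generating relation lies in the span \<open>R\<close>, so it may be used as an
  equation between cosets. Bilinearity of \<open>tens_by\<close> and later the balancing law come
  from this.\<close>

lemma relation_coset_eq:
  assumes "x - y \<in> bilinear_relations M N \<union> X" "x \<in> carrier F" "y \<in> carrier F"
  shows "R +>\<^bsub>F\<^esub> x = R +>\<^bsub>F\<^esub> y"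
proof (rule Q.coset_eqI)
  show "x \<ominus>\<^bsub>F\<^esub> y \<in> R"
    unfolding free_space_minus[OF assms(2,3)] relation_space_def linear_span_def
    by (rule hull_inc[OF assms(1)])
qed (use assms in auto)

lemma coset_single:
  assumes "m \<in> carrier M" "n \<in> carrier N"
  shows "R +>\<^bsub>F\<^esub> Poly_Mapping.single (m, n) c = c \<odot>\<^bsub>T\<^esub> tens_by X M N m n"
proof -
  have "Poly_Mapping.map ((*) c) (pair_of m n) = Poly_Mapping.single (m, n) c" by simp
  then show ?thesis
    using Q.smult_quotient[OF single_closed[OF assms, of 1], of c]
    by (simp add: tensor_by_def tens_by_def)
qed

lemma bilinear_map_tens_by: "bilinear_map M N T (tens_by X M N)"
proof -
  note closed = add_closed'[OF left] add_closed'[OF right] smult_closed'[OF left]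
    smult_closed'[OF right]
  have add: "(R +>\<^bsub>F\<^esub> x) \<oplus>\<^bsub>T\<^esub> (R +>\<^bsub>F\<^esub> y) = R +>\<^bsub>F\<^esub> (x + y)"
    if "x \<in> carrier F" "y \<in> carrier F" for x y
    using Q.add_quotient[OF that] by (simp add: tensor_by_def)
  have plus: "x + y \<in> carrier F" if "x \<in> carrier F" "y \<in> carrier F" for x y
    using add_closed'[OF complex_space_free_space that] by simp
  show ?thesis
  proof (intro bilinear_mapI linear_mapI tens_by_closed)
    fix m n n' assume "m \<in> carrier M" "n \<in> carrier N" "n' \<in> carrier N"
    \<comment> \<open>The generator has the form \<open>x - y - z\<close>; regrouped as
      \<open>x - (y + z)\<close>, it compares the two cosets at hand.\<close>
    then show "tens_by X M N m (n \<oplus>\<^bsub>N\<^esub> n') = tens_by X M N m n \<oplus>\<^bsub>T\<^esub> tens_by X M N m n'"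
      unfolding tens_by_def
      by (subst add; intro single_closed relation_coset_eq plus closed;
          (auto simp: bilinear_relations_def diff_diff_add)?)
  next
    fix m m' n assume "m \<in> carrier M" "m' \<in> carrier M" "n \<in> carrier N"
    then show "tens_by X M N (m \<oplus>\<^bsub>M\<^esub> m') n = tens_by X M N m n \<oplus>\<^bsub>T\<^esub> tens_by X M N m' n"
      unfolding tens_by_def
      by (subst add; intro single_closed relation_coset_eq plus closed;
          (auto simp: bilinear_relations_def diff_diff_add)?)
  next
    fix c m n assume mn: "m \<in> carrier M" "n \<in> carrier N"
    \<comment> \<open>Both right-hand sides are read as the coset of
      \<open>Poly_Mapping.single (m, n) c\<close>, the form in which the scalar relations are
      stated.\<close>
    show "tens_by X M N m (c \<odot>\<^bsub>N\<^esub> n) = c \<odot>\<^bsub>T\<^esub> tens_by X M N m n"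
      "tens_by X M N (c \<odot>\<^bsub>M\<^esub> m) n = c \<odot>\<^bsub>T\<^esub> tens_by X M N m n"
      unfolding coset_single[OF mn, symmetric] unfolding tens_by_def
      using mn by (intro relation_coset_eq single_closed closed; force simp: bilinear_relations_def)+
  qed (use closed in auto)
qed

text \<open>Every coset has a formal combination as representative, and induction on that
  combination adds one monomial at a time. In the quotient a monomial becomes a scalar multiple of a
  simple tensor.\<close>

lemma tensor_by_induct [consumes 1, case_names zero add]:
  assumes t: "t \<in> carrier T" and zero: "P \<zero>\<^bsub>T\<^esub>"
    and add: "\<And>c m n s. \<lbrakk>m \<in> carrier M; n \<in> carrier N; s \<in> carrier T; P s\<rbrakk> \<Longrightarrow>
      P ((c \<odot>\<^bsub>T\<^esub> tens_by X M N m n) \<oplus>\<^bsub>T\<^esub> s)"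
  shows "P t"
proof -
  obtain x where x: "x \<in> carrier F" "t = R +>\<^bsub>F\<^esub> x"
    using t by (auto simp: tensor_by_def Q.carrier_quotient)
  have "P (R +>\<^bsub>F\<^esub> x)" using x(1)
  proof (induction x rule: free_space_induct)
    case zero
    then show ?case using assms(2) by (simp add: tensor_by_def Q.zero_quotient)
  next
    case (add s c x)
    obtain m n where s: "s = (m, n)" "m \<in> carrier M" "n \<in> carrier N" using add(1) by auto
    have "R +>\<^bsub>F\<^esub> (Poly_Mapping.single s c + x) =
        (R +>\<^bsub>F\<^esub> Poly_Mapping.single s c) \<oplus>\<^bsub>T\<^esub> (R +>\<^bsub>F\<^esub> x)"
      using Q.add_quotient[OF single_closed[OF s(2,3)] add(2)] s by (simp add: tensor_by_def)
    also have "\<dots> = c \<odot>\<^bsub>T\<^esub> tens_by X M N m n \<oplus>\<^bsub>T\<^esub> (R +>\<^bsub>F\<^esub> x)"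
      using coset_single[OF s(2,3)] s by simp
    moreover have "R +>\<^bsub>F\<^esub> x \<in> carrier T"
      using add(2) by (simp add: tensor_by_def Q.carrier_quotient)
    ultimately show ?case using assms(3) s add(3) by metis
  qed
  then show ?thesis using x by simp
qed

text \<open>This is the uniqueness half of the universal property: simple tensors span. Identities
  between linear maps are reduced to simple tensors by it.\<close>

lemma tensor_by_ext:
  assumes P: "complex_space P" and f: "linear_map T P f" and h: "linear_map T P h"
    and eq: "\<And>m n. \<lbrakk>m \<in> carrier M; n \<in> carrier N\<rbrakk> \<Longrightarrow> f (tens_by X M N m n) = h (tens_by X M N m n)"
    and t: "t \<in> carrier T"
  shows "f t = h t"
  using t
proof (induction t rule: tensor_by_induct)
  case zero
  show ?case
    using linear_map_zero[OF complex_space_tensor_by P] f h by metis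
next
  case (add c m n s)
  then show ?case
    using linear_map_add[OF f] linear_map_add[OF h] linear_map_smult[OF f] linear_map_smult[OF h]
    by (simp add: tens_by_closed smult_closed'[OF complex_space_tensor_by] eq)
qed

section \<open>Existence half of the universal property\<close>

context
  fixes P :: "(complex, 'p, 'z) module_scheme" and \<beta>
  assumes P: "complex_space P" and b: "bilinear_map M N P \<beta>"
    and rel: "\<And>x. x \<in> X \<Longrightarrow> eval_formal P \<beta> x = \<zero>\<^bsub>P\<^esub>"
begin

interpretation P: module complex_alg P by (rule P)

lemma eval_formal_linear: "linear_map F P (eval_formal P \<beta>)"
  by (rule linear_map_eval_formal[OF P]) (auto intro: bilinear_map_closed[OF b])

text \<open>Bilinearity of \<open>\<beta>\<close> makes the evaluation vanish on the bilinear
  relations, and \<open>rel\<close> does so on those in \<open>X\<close>; since evaluation is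
  linear, it vanishes on their span.\<close>

lemma eval_formal_relations:
  assumes "x \<in> R"
  shows "eval_formal P \<beta> x = \<zero>\<^bsub>P\<^esub>"
proof (rule span_subset_kernel[OF complex_space_free_space P eval_formal_linear relations_closed])
  note closed = add_closed'[OF left] add_closed'[OF right] smult_closed'[OF left]
    smult_closed'[OF right]
  note diff = linear_map_free_diff[OF P eval_formal_linear]
  have single: "eval_formal P \<beta> (Poly_Mapping.single (m, n) c) = c \<odot>\<^bsub>P\<^esub> \<beta> m n"
    if "m \<in> carrier M" "n \<in> carrier N" for m n c
    by (rule eval_formal_single[OF P, where \<beta> = \<beta>, OF bilinear_map_closed[OF b that]])
  note simps = diff single closed single_closed free_space_diff_closed
    linear_map_add[OF bilinear_map_left[OF b]] linear_map_add[OF bilinear_map_right[OF b]]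
    linear_map_smult[OF bilinear_map_left[OF b]] linear_map_smult[OF bilinear_map_right[OF b]]
    bilinear_map_closed[OF b] smult_closed'[OF P]
  have one: "1 \<odot>\<^bsub>P\<^esub> y = y" if "y \<in> carrier P" for y using P.smult_one[OF that] by simp
  \<comment> \<open>An additive relation evaluates to \<open>a + b - a - b\<close>; this is its form
    once all sums are associated to the right.\<close>
  have cancel: "a \<oplus>\<^bsub>P\<^esub> (b \<oplus>\<^bsub>P\<^esub> (\<ominus>\<^bsub>P\<^esub> a \<oplus>\<^bsub>P\<^esub> \<ominus>\<^bsub>P\<^esub> b)) = \<zero>\<^bsub>P\<^esub>"
    if "a \<in> carrier P" "b \<in> carrier P" for a b
    using that by (simp add: P.a_lcomm[of b "\<ominus>\<^bsub>P\<^esub> a"] P.r_neg P.r_neg2)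
  fix x assume "x \<in> bilinear_relations M N \<union> X"
  then show "eval_formal P \<beta> x = \<zero>\<^bsub>P\<^esub>"
    unfolding bilinear_relations_def
    by (elim UnE CollectE exE conjE; (simp only: rel)?)
      (simp_all add: simps one P.r_neg a_minus_def P.a_assoc cancel del: free_space_simps)
qed (use assms in \<open>simp add: relation_space_def\<close>)

text \<open>Evaluation is constant on a coset of \<open>R\<close>, so its image is a singleton and
  \<open>the_elem\<close> in \<open>lift\<close> returns the expected value.\<close>

lemma lift_coset:
  assumes "x \<in> carrier F"
  shows "lift P \<beta> (R +>\<^bsub>F\<^esub> x) = eval_formal P \<beta> x"
proof -
  have "eval_formal P \<beta> (r + x) = eval_formal P \<beta> x" if "r \<in> R" for r
  proof -
    have "r \<in> carrier F" using that module.submoduleE(1)[OF Q.space Q.sub] by blast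
    then show ?thesis
      using linear_map_add[OF eval_formal_linear _ assms, of r] eval_formal_relations[OF that]
        linear_map_closed[OF eval_formal_linear assms] by simp
  qed
  \<comment> \<open>This puts \<open>x\<close> itself into the coset, so that the image is not
    empty.\<close>
  moreover have "0 \<in> R"
    using subgroup.one_closed[OF submodule.axioms(1)[OF Q.sub]] by simp
  ultimately have "eval_formal P \<beta> ` (R +>\<^bsub>F\<^esub> x) = {eval_formal P \<beta> x}"
    by (auto simp: a_r_coset_def' intro!: image_eqI[of _ _ "0 + x"])
  then show ?thesis by (simp add: lift_def)
qed

lemma lift_tens_by:
  assumes "m \<in> carrier M" "n \<in> carrier N"
  shows "lift P \<beta> (tens_by X M N m n) = \<beta> m n"
  using lift_coset[OF single_closed[OF assms, of 1]] P.smult_one[of "\<beta> m n"]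
    bilinear_map_closed[OF b assms]
  by (simp add: tens_by_def eval_formal_single[OF P])

lemma linear_map_lift_by: "linear_map T P (lift P \<beta>)"
proof (rule linear_mapI)
  fix x assume "x \<in> carrier T"
  then obtain u where u: "u \<in> carrier F" "x = R +>\<^bsub>F\<^esub> u"
    by (auto simp: tensor_by_def Q.carrier_quotient)
  then show "lift P \<beta> x \<in> carrier P"
    by (simp add: lift_coset linear_map_closed[OF eval_formal_linear] del: free_space_simps)
  show "lift P \<beta> (c \<odot>\<^bsub>T\<^esub> x) = c \<odot>\<^bsub>P\<^esub> lift P \<beta> x" for c
    using u Q.smult_quotient[OF u(1), of c] linear_map_smult[OF eval_formal_linear u(1), of c]
      lift_coset smult_closed'[OF Q.space u(1), of c]
    by (simp add: tensor_by_def)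
  fix y assume "y \<in> carrier T"
  then obtain v where v: "v \<in> carrier F" "y = R +>\<^bsub>F\<^esub> v"
    by (auto simp: tensor_by_def Q.carrier_quotient)
  then show "lift P \<beta> (x \<oplus>\<^bsub>T\<^esub> y) = lift P \<beta> x \<oplus>\<^bsub>P\<^esub> lift P \<beta> y"
    using u Q.add_quotient[OF u(1) v(1)] linear_map_add[OF eval_formal_linear u(1) v(1)]
      lift_coset add_closed'[OF Q.space u(1) v(1)]
    by (simp add: tensor_by_def)
qed

end

end

section \<open>Tensor products over the complex numbers\<close>

lemma tensor_relations_empty: "\<lbrakk>complex_space M; complex_space N\<rbrakk> \<Longrightarrow> tensor_relations {} M N"
  by (simp add: tensor_relations_def)

lemmas complex_space_tensor = tensor_relations.complex_space_tensor_by[OF tensor_relations_empty]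
  and bilinear_map_tens = tensor_relations.bilinear_map_tens_by[OF tensor_relations_empty]
  and tensor_ext = tensor_relations.tensor_by_ext[OF tensor_relations_empty]
  and tens_closed = tensor_relations.tens_by_closed[OF tensor_relations_empty]

lemma linear_map_lift:
  assumes "complex_space M" "complex_space N" "complex_space P" "bilinear_map M N P \<beta>"
  shows "linear_map (tensor M N) P (lift P \<beta>)"
  by (rule tensor_relations.linear_map_lift_by[OF tensor_relations_empty]) (use assms in auto)

lemma lift_tens:
  assumes "complex_space M" "complex_space N" "complex_space P" "bilinear_map M N P \<beta>"
    and "m \<in> carrier M" "n \<in> carrier N"
  shows "lift P \<beta> (tens M N m n) = \<beta> m n"
  by (rule tensor_relations.lift_tens_by[OF tensor_relations_empty]) (use assms in auto)

text \<open>Handles nested lifts, where the bilinear map to be lifted depends on a parameter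
  \<open>u\<close>. Linearity in \<open>u\<close> at a fixed \<open>t\<close> is an equation between
  maps that are linear in \<open>t\<close>, so it needs checking only on simple tensors, where it is
  the premise \<open>l\<close>.\<close>

lemma bilinear_map_lift:
  assumes M: "complex_space M" and N: "complex_space N" and P: "complex_space P"
    and U: "complex_space U"
    and b: "\<And>u. u \<in> carrier U \<Longrightarrow> bilinear_map M N P (\<beta> u)"
    and l: "\<And>m n. \<lbrakk>m \<in> carrier M; n \<in> carrier N\<rbrakk> \<Longrightarrow> linear_map U P (\<lambda>u. \<beta> u m n)"
  shows "bilinear_map U (tensor M N) P (\<lambda>u. lift P (\<beta> u))"
proof (rule bilinear_mapI)
  note lin = linear_map_lift[OF M N P b]
  note val = lift_tens[OF M N P b]
  show "linear_map (tensor M N) P (lift P (\<beta> u))" if "u \<in> carrier U" for u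
    by (rule lin[OF that])
  fix t assume t: "t \<in> carrier (tensor M N)"
  show "linear_map U P (\<lambda>u. lift P (\<beta> u) t)"
  proof (rule linear_mapI)
    fix u assume u: "u \<in> carrier U"
    show "lift P (\<beta> u) t \<in> carrier P" by (rule linear_map_closed[OF lin[OF u] t])
    show "lift P (\<beta> (c \<odot>\<^bsub>U\<^esub> u)) t = c \<odot>\<^bsub>P\<^esub> lift P (\<beta> u) t" for c
    proof (rule tensor_ext[OF M N P lin linear_map_scaled[OF P lin] _ t])
      show "lift P (\<beta> (c \<odot>\<^bsub>U\<^esub> u)) (tens M N m n) = c \<odot>\<^bsub>P\<^esub> lift P (\<beta> u) (tens M N m n)"
        if "m \<in> carrier M" "n \<in> carrier N" for m n
        using linear_map_smult[OF l[OF that] u] by (simp add: val that u smult_closed'[OF U])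
    qed (simp_all add: u smult_closed'[OF U])
    fix v assume v: "v \<in> carrier U"
    show "lift P (\<beta> (u \<oplus>\<^bsub>U\<^esub> v)) t = lift P (\<beta> u) t \<oplus>\<^bsub>P\<^esub> lift P (\<beta> v) t"
    proof (rule tensor_ext[OF M N P lin linear_map_sum[OF P lin lin] _ t])
      show "lift P (\<beta> (u \<oplus>\<^bsub>U\<^esub> v)) (tens M N m n) =
          lift P (\<beta> u) (tens M N m n) \<oplus>\<^bsub>P\<^esub> lift P (\<beta> v) (tens M N m n)"
        if "m \<in> carrier M" "n \<in> carrier N" for m n
        using linear_map_add[OF l[OF that] u v] by (simp add: val that u v add_closed'[OF U])
    qed (simp_all add: u v add_closed'[OF U])
  qed
qed

text \<open>Freezing one argument at a time reduces the claim to \<open>tensor_ext\<close>, first in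
  \<open>s\<close> and then in \<open>t\<close>.\<close>

lemma bilinear_tensor_ext:
  assumes spaces: "complex_space M" "complex_space N" "complex_space K" "complex_space L"
      "complex_space P"
    and f: "bilinear_map (tensor M N) (tensor K L) P f"
    and h: "bilinear_map (tensor M N) (tensor K L) P h"
    and eq: "\<And>m n k l. \<lbrakk>m \<in> carrier M; n \<in> carrier N; k \<in> carrier K; l \<in> carrier L\<rbrakk> \<Longrightarrow>
      f (tens M N m n) (tens K L k l) = h (tens M N m n) (tens K L k l)"
    and s: "s \<in> carrier (tensor M N)" and t: "t \<in> carrier (tensor K L)"
  shows "f s t = h s t"
proof (rule tensor_ext[OF spaces(1,2,5) bilinear_map_left[OF f t] bilinear_map_left[OF h t] _ s])
  fix m n assume mn: "m \<in> carrier M" "n \<in> carrier N"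
  note c = tens_closed[OF spaces(1,2) mn]
  show "f (tens M N m n) t = h (tens M N m n) t"
    by (rule tensor_ext[OF spaces(3,4,5) bilinear_map_right[OF f c] bilinear_map_right[OF h c] _ t])
      (rule eq[OF mn])
qed

section \<open>Maps between tensor products\<close>

context
  fixes M :: "(complex, 'm, 'x1) module_scheme" and N :: "(complex, 'n, 'x2) module_scheme"
    and P :: "(complex, 'p, 'x3) module_scheme" and Q :: "(complex, 'q, 'x4) module_scheme"
    and f h
  assumes spaces: "complex_space M" "complex_space N" "complex_space P" "complex_space Q"
    and f: "linear_map M P f" and h: "linear_map N Q h"
begin

lemma bilinear_map_tens_map: "bilinear_map M N (tensor P Q) (\<lambda>m n. tens P Q (f m) (h n))"
  by (rule bilinear_map_comp_args[OF bilinear_map_tens f h]) (fact spaces)+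

lemma linear_map_tensor_map: "linear_map (tensor M N) (tensor P Q) (tensor_map P Q f h)"
  unfolding tensor_map_def
  by (intro linear_map_lift bilinear_map_tens_map complex_space_tensor spaces)

lemma tensor_map_tens:
  "\<lbrakk>m \<in> carrier M; n \<in> carrier N\<rbrakk> \<Longrightarrow> tensor_map P Q f h (tens M N m n) = tens P Q (f m) (h n)"
  unfolding tensor_map_def
  by (rule lift_tens) (intro bilinear_map_tens_map complex_space_tensor spaces | assumption)+

end

section \<open>The associator\<close>

context
  fixes U :: "(complex, 'u, 'x1) module_scheme" and V :: "(complex, 'v, 'x2) module_scheme"
    and W :: "(complex, 'w, 'x3) module_scheme"
  assumes spaces: "complex_space U" "complex_space V" "complex_space W"
begin

private lemma bilinear_assoc_inner:
  assumes "w \<in> carrier W"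
  shows "bilinear_map U V (tensor U (tensor V W)) (\<lambda>u v. tens U (tensor V W) u (tens V W v w))"
  by (rule bilinear_map_comp_args[OF bilinear_map_tens linear_map_id
        bilinear_map_left[OF bilinear_map_tens assms]]) (intro spaces complex_space_tensor)+

private lemma bilinear_assoc_outer:
  "bilinear_map (tensor U V) W (tensor U (tensor V W))
    (\<lambda>s w. lift (tensor U (tensor V W)) (\<lambda>u v. tens U (tensor V W) u (tens V W v w)) s)"
\<comment> \<open>\<open>bilinear_map_lift\<close> takes the parameter as first argument, and here
  the parameter is \<open>w\<close>; hence the exchange.\<close>
proof (rule bilinear_map_swap, rule bilinear_map_lift)
  fix u v assume u: "u \<in> carrier U" and v: "v \<in> carrier V"
  show "linear_map W (tensor U (tensor V W)) (\<lambda>w. tens U (tensor V W) u (tens V W v w))"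
    by (rule linear_map_comp[OF bilinear_map_right[OF bilinear_map_tens v]
          bilinear_map_right[OF bilinear_map_tens u]]) (intro spaces complex_space_tensor)+
qed (intro spaces complex_space_tensor bilinear_assoc_inner | assumption)+

lemma linear_map_tensor_assoc:
  "linear_map (tensor (tensor U V) W) (tensor U (tensor V W)) (tensor_assoc U V W)"
  unfolding tensor_assoc_def
  by (intro linear_map_lift bilinear_assoc_outer complex_space_tensor spaces)

lemma tensor_assoc_tens:
  assumes "u \<in> carrier U" "v \<in> carrier V" "w \<in> carrier W"
  shows "tensor_assoc U V W (tens (tensor U V) W (tens U V u v) w) =
    tens U (tensor V W) u (tens V W v w)"
proof -
  have "tensor_assoc U V W (tens (tensor U V) W (tens U V u v) w) =
      lift (tensor U (tensor V W)) (\<lambda>u v. tens U (tensor V W) u (tens V W v w)) (tens U V u v)"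
    unfolding tensor_assoc_def
    by (rule lift_tens) (intro bilinear_assoc_outer complex_space_tensor spaces tens_closed assms)+
  also have "\<dots> = tens U (tensor V W) u (tens V W v w)"
    by (rule lift_tens) (intro bilinear_assoc_inner complex_space_tensor spaces assms)+
  finally show ?thesis .
qed

end

section \<open>Componentwise products\<close>

context
  fixes M :: "(complex, 'm, 'x1) module_scheme" and N :: "(complex, 'n, 'x2) module_scheme"
    and P :: "(complex, 'p, 'x3) module_scheme"
    and K :: "(complex, 'k, 'x4) module_scheme" and L :: "(complex, 'l, 'x5) module_scheme"
    and Q :: "(complex, 'q, 'x6) module_scheme" and \<beta> \<gamma>
  assumes spaces: "complex_space M" "complex_space N" "complex_space P"
      "complex_space K" "complex_space L" "complex_space Q"
    and b: "bilinear_map M N P \<beta>" and c: "bilinear_map K L Q \<gamma>"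
begin

private lemma bilinear_mult_inner:
  assumes "m \<in> carrier M" "k \<in> carrier K"
  shows "bilinear_map N L (tensor P Q) (\<lambda>n l. tens P Q (\<beta> m n) (\<gamma> k l))"
  by (rule bilinear_map_tens_map) (intro spaces bilinear_map_right[OF b] bilinear_map_right[OF c] assms)+

private lemma bilinear_mult_outer:
  assumes t: "t \<in> carrier (tensor N L)"
  shows "bilinear_map M K (tensor P Q)
    (\<lambda>m k. lift (tensor P Q) (\<lambda>n l. tens P Q (\<beta> m n) (\<gamma> k l)) t)"
proof (rule bilinear_mapI)
  fix m assume m: "m \<in> carrier M"
  have "bilinear_map K (tensor N L) (tensor P Q)
      (\<lambda>k. lift (tensor P Q) (\<lambda>n l. tens P Q (\<beta> m n) (\<gamma> k l)))"
  proof (rule bilinear_map_lift)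
    fix n l assume "n \<in> carrier N" "l \<in> carrier L"
    then show "linear_map K (tensor P Q) (\<lambda>k. tens P Q (\<beta> m n) (\<gamma> k l))"
      by (intro linear_map_comp[OF bilinear_map_left[OF c] bilinear_map_right[OF bilinear_map_tens]]
          bilinear_map_closed[OF b] spaces m)
  qed (intro spaces complex_space_tensor bilinear_mult_inner m | assumption)+
  then show "linear_map K (tensor P Q) (\<lambda>k. lift (tensor P Q) (\<lambda>n l. tens P Q (\<beta> m n) (\<gamma> k l)) t)"
    by (rule bilinear_map_left) (rule t)
next
  fix k assume k: "k \<in> carrier K"
  have "bilinear_map M (tensor N L) (tensor P Q)
      (\<lambda>m. lift (tensor P Q) (\<lambda>n l. tens P Q (\<beta> m n) (\<gamma> k l)))"
  proof (rule bilinear_map_lift)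
    fix n l assume "n \<in> carrier N" "l \<in> carrier L"
    then show "linear_map M (tensor P Q) (\<lambda>m. tens P Q (\<beta> m n) (\<gamma> k l))"
      by (intro linear_map_comp[OF bilinear_map_left[OF b] bilinear_map_left[OF bilinear_map_tens]]
          bilinear_map_closed[OF c] spaces k)
  qed (intro spaces complex_space_tensor bilinear_mult_inner k | assumption)+
  then show "linear_map M (tensor P Q) (\<lambda>m. lift (tensor P Q) (\<lambda>n l. tens P Q (\<beta> m n) (\<gamma> k l)) t)"
    by (rule bilinear_map_left) (rule t)
qed

lemma tensor_mult_tens:
  assumes "m \<in> carrier M" "n \<in> carrier N" "k \<in> carrier K" "l \<in> carrier L"
  shows "tensor_mult P Q \<beta> \<gamma> (tens M K m k) (tens N L n l) = tens P Q (\<beta> m n) (\<gamma> k l)"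
proof -
  have "tensor_mult P Q \<beta> \<gamma> (tens M K m k) (tens N L n l) =
      lift (tensor P Q) (\<lambda>n l. tens P Q (\<beta> m n) (\<gamma> k l)) (tens N L n l)"
    unfolding tensor_mult_def
    by (rule lift_tens) (intro bilinear_mult_outer complex_space_tensor spaces tens_closed assms)+
  also have "\<dots> = tens P Q (\<beta> m n) (\<gamma> k l)"
    by (rule lift_tens) (intro bilinear_mult_inner complex_space_tensor spaces assms)+
  finally show ?thesis .
qed

lemma bilinear_map_tensor_mult:
  "bilinear_map (tensor M K) (tensor N L) (tensor P Q) (tensor_mult P Q \<beta> \<gamma>)"
proof -
  \<comment> \<open>The outer lift in \<open>tensor_mult\<close> runs over \<open>s\<close>, so
    \<open>t\<close> is the parameter and the arguments are exchanged.\<close>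
  have "bilinear_map (tensor N L) (tensor M K) (tensor P Q) (\<lambda>t s. tensor_mult P Q \<beta> \<gamma> s t)"
    unfolding tensor_mult_def
  proof (rule bilinear_map_lift)
    fix m k assume mk: "m \<in> carrier M" "k \<in> carrier K"
    show "linear_map (tensor N L) (tensor P Q)
        (\<lambda>t. lift (tensor P Q) (\<lambda>n l. tens P Q (\<beta> m n) (\<gamma> k l)) t)"
      by (intro linear_map_lift bilinear_mult_inner spaces complex_space_tensor mk)
  qed (intro spaces complex_space_tensor bilinear_mult_outer | assumption)+
  then show ?thesis by (rule bilinear_map_swap)
qed

end

text \<open>Functoriality. The composites need to agree with \<open>f''\<close> and
  \<open>h''\<close> on carriers only, since the later application replaces a composite by
  \<open>g\<close> under the hypothesis of invariance, which says nothing off the carrier.\<close>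

lemma tensor_map_tensor_map:
  assumes spaces: "complex_space M" "complex_space N" "complex_space P" "complex_space Q"
      "complex_space P'" "complex_space Q'"
    and f: "linear_map M P f" and h: "linear_map N Q h"
    and f': "linear_map P P' f'" and h': "linear_map Q Q' h'"
    and f'': "\<And>m. m \<in> carrier M \<Longrightarrow> f'' m = f' (f m)"
    and h'': "\<And>n. n \<in> carrier N \<Longrightarrow> h'' n = h' (h n)"
    and t: "t \<in> carrier (tensor M N)"
  shows "tensor_map P' Q' f' h' (tensor_map P Q f h t) = tensor_map P' Q' f'' h'' t"
proof -
  note lin = linear_map_cong[OF spaces(1) f'' linear_map_comp[OF f f']]
    linear_map_cong[OF spaces(2) h'' linear_map_comp[OF h h']]
  note F = tensor_map_tens[OF spaces(1-4) f h] and F' = tensor_map_tens[OF spaces(3-6) f' h']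
    and F'' = tensor_map_tens[OF spaces(1,2,5,6) lin]
  show ?thesis
  proof (rule tensor_ext[OF spaces(1,2) complex_space_tensor[OF spaces(5,6)]
        linear_map_comp[OF linear_map_tensor_map[OF spaces(1-4) f h]
          linear_map_tensor_map[OF spaces(3-6) f' h']]
        linear_map_tensor_map[OF spaces(1,2,5,6) lin] _ t])
    fix m n assume "m \<in> carrier M" "n \<in> carrier N"
    then show "tensor_map P' Q' f' h' (tensor_map P Q f h (tens M N m n)) =
        tensor_map P' Q' f'' h'' (tens M N m n)"
      by (simp add: F F' F'' f'' h'' linear_map_closed[OF f] linear_map_closed[OF h])
  qed
qed

text \<open>Both sides are bilinear in \<open>s\<close> and \<open>t\<close>, and on simple tensors
  the claim is \<open>f_mult\<close> in one leg and \<open>h_mult\<close> in the other. Three spaces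
  per leg are kept apart because the factors and the values of a module pairing live in different
  spaces.\<close>

lemma tensor_map_tensor_mult:
  assumes src: "complex_space M1" "complex_space M2" "complex_space M3"
      "complex_space N1" "complex_space N2" "complex_space N3"
    and tgt: "complex_space P1" "complex_space P2" "complex_space P3"
      "complex_space Q1" "complex_space Q2" "complex_space Q3"
    and f: "linear_map M1 P1 f1" "linear_map M2 P2 f2" "linear_map M3 P3 f3"
    and h: "linear_map N1 Q1 h1" "linear_map N2 Q2 h2" "linear_map N3 Q3 h3"
    and \<beta>: "bilinear_map M1 M2 M3 \<beta>" and \<gamma>: "bilinear_map N1 N2 N3 \<gamma>"
    and \<beta>': "bilinear_map P1 P2 P3 \<beta>'" and \<gamma>': "bilinear_map Q1 Q2 Q3 \<gamma>'"
    and f_mult: "\<And>x y. \<lbrakk>x \<in> carrier M1; y \<in> carrier M2\<rbrakk> \<Longrightarrow> f3 (\<beta> x y) = \<beta>' (f1 x) (f2 y)"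
    and h_mult: "\<And>x y. \<lbrakk>x \<in> carrier N1; y \<in> carrier N2\<rbrakk> \<Longrightarrow> h3 (\<gamma> x y) = \<gamma>' (h1 x) (h2 y)"
    and s: "s \<in> carrier (tensor M1 N1)" and t: "t \<in> carrier (tensor M2 N2)"
  shows "tensor_map P3 Q3 f3 h3 (tensor_mult M3 N3 \<beta> \<gamma> s t) =
    tensor_mult P3 Q3 \<beta>' \<gamma>' (tensor_map P1 Q1 f1 h1 s) (tensor_map P2 Q2 f2 h2 t)"
proof (rule bilinear_tensor_ext[OF src(1,4,2,5) complex_space_tensor[OF tgt(3,6)]
      bilinear_map_comp_result[OF bilinear_map_tensor_mult[OF src \<beta> \<gamma>]
        linear_map_tensor_map[OF src(3,6) tgt(3,6) f(3) h(3)]]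
      bilinear_map_comp_args[OF bilinear_map_tensor_mult[OF tgt \<beta>' \<gamma>']
        linear_map_tensor_map[OF src(1,4) tgt(1,4) f(1) h(1)]
        linear_map_tensor_map[OF src(2,5) tgt(2,5) f(2) h(2)]] _ s t])
  fix m n k l assume "m \<in> carrier M1" "n \<in> carrier N1" "k \<in> carrier M2" "l \<in> carrier N2"
  then show "tensor_map P3 Q3 f3 h3
        (tensor_mult M3 N3 \<beta> \<gamma> (tens M1 N1 m n) (tens M2 N2 k l)) =
      tensor_mult P3 Q3 \<beta>' \<gamma>' (tensor_map P1 Q1 f1 h1 (tens M1 N1 m n))
        (tensor_map P2 Q2 f2 h2 (tens M2 N2 k l))"
    by (simp add: tensor_mult_tens[OF src \<beta> \<gamma>] tensor_mult_tens[OF tgt \<beta>' \<gamma>']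
        tensor_map_tens[OF src(1,4) tgt(1,4) f(1) h(1)]
        tensor_map_tens[OF src(2,5) tgt(2,5) f(2) h(2)]
        tensor_map_tens[OF src(3,6) tgt(3,6) f(3) h(3)]
        linear_map_closed[OF f(1)] linear_map_closed[OF f(2)]
        linear_map_closed[OF h(1)] linear_map_closed[OF h(2)]
        bilinear_map_closed[OF \<beta>] bilinear_map_closed[OF \<gamma>] f_mult h_mult)
qed

text \<open>Reassociating commutes with multiplying leg by leg. Elements of
  \<open>(U \<otimes> V) \<otimes> W\<close> need two reductions to simple tensors, one for each
  level of nesting.\<close>

lemma tensor_assoc_tensor_mult:
  assumes U: "complex_space U1" "complex_space U2" "complex_space U3"
    and V: "complex_space V1" "complex_space V2" "complex_space V3"
    and W: "complex_space W1" "complex_space W2" "complex_space W3"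
    and \<alpha>: "bilinear_map U1 U2 U3 \<alpha>" and \<beta>: "bilinear_map V1 V2 V3 \<beta>"
    and \<gamma>: "bilinear_map W1 W2 W3 \<gamma>"
    and s: "s \<in> carrier (tensor (tensor U1 V1) W1)" and t: "t \<in> carrier (tensor (tensor U2 V2) W2)"
  shows "tensor_assoc U3 V3 W3
      (tensor_mult (tensor U3 V3) W3 (tensor_mult U3 V3 \<alpha> \<beta>) \<gamma> s t) =
    tensor_mult U3 (tensor V3 W3) \<alpha> (tensor_mult V3 W3 \<beta> \<gamma>)
      (tensor_assoc U1 V1 W1 s) (tensor_assoc U2 V2 W2 t)"
proof -
  note UV = complex_space_tensor[OF U(1) V(1)] complex_space_tensor[OF U(2) V(2)]
    complex_space_tensor[OF U(3) V(3)]
  note VW = complex_space_tensor[OF V(1) W(1)] complex_space_tensor[OF V(2) W(2)]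
    complex_space_tensor[OF V(3) W(3)]
  note \<alpha>\<beta> = bilinear_map_tensor_mult[OF U V \<alpha> \<beta>] and \<beta>\<gamma> = bilinear_map_tensor_mult[OF V W \<beta> \<gamma>]
  let ?l = "\<lambda>s t. tensor_assoc U3 V3 W3
      (tensor_mult (tensor U3 V3) W3 (tensor_mult U3 V3 \<alpha> \<beta>) \<gamma> s t)"
  let ?r = "\<lambda>s t. tensor_mult U3 (tensor V3 W3) \<alpha> (tensor_mult V3 W3 \<beta> \<gamma>)
      (tensor_assoc U1 V1 W1 s) (tensor_assoc U2 V2 W2 t)"
  note L = bilinear_map_comp_result[OF bilinear_map_tensor_mult[OF UV W \<alpha>\<beta> \<gamma>]
      linear_map_tensor_assoc[OF U(3) V(3) W(3)]]
  note R = bilinear_map_comp_args[OF bilinear_map_tensor_mult[OF U VW \<alpha> \<beta>\<gamma>]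
      linear_map_tensor_assoc[OF U(1) V(1) W(1)] linear_map_tensor_assoc[OF U(2) V(2) W(2)]]
  note target = complex_space_tensor[OF U(3) VW(3)]
  show ?thesis
  proof (rule bilinear_tensor_ext[OF UV(1) W(1) UV(2) W(2) target L R _ s t])
    fix p w q z assume p: "p \<in> carrier (tensor U1 V1)" and w: "w \<in> carrier W1"
      and q: "q \<in> carrier (tensor U2 V2)" and z: "z \<in> carrier W2"
    \<comment> \<open>For fixed \<open>w\<close> and \<open>z\<close> both sides remain bilinear in
      \<open>p\<close> and \<open>q\<close>, which permits the second reduction.\<close>
    note w_lin = bilinear_map_left[OF bilinear_map_tens[OF UV(1) W(1)] w]
      and z_lin = bilinear_map_left[OF bilinear_map_tens[OF UV(2) W(2)] z]
    show "?l (tens (tensor U1 V1) W1 p w) (tens (tensor U2 V2) W2 q z) =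
        ?r (tens (tensor U1 V1) W1 p w) (tens (tensor U2 V2) W2 q z)"
    proof (rule bilinear_tensor_ext[OF U(1) V(1) U(2) V(2) target
          bilinear_map_comp_args[OF L w_lin z_lin] bilinear_map_comp_args[OF R w_lin z_lin] _ p q])
      fix u v u' v' assume "u \<in> carrier U1" "v \<in> carrier V1" "u' \<in> carrier U2" "v' \<in> carrier V2"
      then show "?l (tens (tensor U1 V1) W1 (tens U1 V1 u v) w)
            (tens (tensor U2 V2) W2 (tens U2 V2 u' v') z) =
          ?r (tens (tensor U1 V1) W1 (tens U1 V1 u v) w)
            (tens (tensor U2 V2) W2 (tens U2 V2 u' v') z)"
        using w z
        by (simp add: tensor_mult_tens[OF UV W \<alpha>\<beta> \<gamma>] tensor_mult_tens[OF U V \<alpha> \<beta>]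
            tensor_mult_tens[OF U VW \<alpha> \<beta>\<gamma>] tensor_mult_tens[OF V W \<beta> \<gamma>]
            tensor_assoc_tens[OF U(1) V(1) W(1)] tensor_assoc_tens[OF U(2) V(2) W(2)]
            tensor_assoc_tens[OF U(3) V(3) W(3)] tens_closed[OF U(1) V(1)] tens_closed[OF U(2) V(2)]
            tens_closed[OF V(1) W(1)] tens_closed[OF V(2) W(2)]
            bilinear_map_closed[OF \<alpha>] bilinear_map_closed[OF \<beta>] bilinear_map_closed[OF \<gamma>])
    qed
  qed
qed

section \<open>Maps from comodules to the Hopf algebra\<close>

context hopf_algebra
begin

lemma complex_space_A: "complex_space A"
  by (rule module_axioms)

lemmas AA = complex_space_tensor[OF complex_space_A complex_space_A]

lemma bilinear_counit_smult_right:
  assumes "linear_map T A g"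
  shows "bilinear_map T A A (\<lambda>t a. counit A (g t) \<odot> a)"
  by (rule bilinear_map_comp_args[OF bilinear_map_smult[OF complex_space_A]
        linear_map_comp[OF assms counit_linear] linear_map_id])

lemmas bilinear_counit_smult_left = bilinear_map_swap[OF bilinear_counit_smult_right]

section \<open>Invariance and covariance for a left coaction\<close>

context
  fixes T :: "(complex, 't, 'x) module_scheme" and g and \<delta>
  assumes T: "complex_space T" and g: "linear_map T A g"
    and \<delta>: "linear_map T (tensor A T) \<delta>"
    and coassoc: "\<And>t. t \<in> carrier T \<Longrightarrow>
      tensor_assoc A A T (tensor_map (tensor A A) T (comult A) id (\<delta> t)) =
      tensor_map A (tensor A T) id \<delta> (\<delta> t)"
begin

text \<open>This is \<open>id \<otimes> \<epsilon>g\<close>, with the target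
  \<open>A \<otimes> \<complex>\<close> identified with \<open>A\<close>.\<close>

private abbreviation "\<Phi> \<equiv> lift A (\<lambda>a t. counit A (g t) \<odot> a)"

private lemmas AT = complex_space_tensor[OF complex_space_A T]
private lemmas \<Phi> = linear_map_lift[OF complex_space_A T complex_space_A bilinear_counit_smult_left[OF g]]
private lemmas \<Phi>_tens = lift_tens[OF complex_space_A T complex_space_A bilinear_counit_smult_left[OF g]]
private lemmas id_\<Phi> = linear_map_tensor_map[OF complex_space_A AT complex_space_A complex_space_A linear_map_id' \<Phi>]
private lemmas id_\<Phi>_tens = tensor_map_tens[OF complex_space_A AT complex_space_A complex_space_A linear_map_id' \<Phi>]
private lemmas \<Delta>_id = linear_map_tensor_map[OF complex_space_A T AA T comult_linear linear_map_id']
private lemmas \<Delta>_id_tens = tensor_map_tens[OF complex_space_A T AA T comult_linear linear_map_id']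
private lemmas assoc_AAT = linear_map_tensor_assoc[OF complex_space_A complex_space_A T]

text \<open>On \<open>a \<otimes> t\<close> both sides give \<open>\<epsilon>(g t)\<close> times
  \<open>\<Delta>(a)\<close>. The right side is arranged so that coassociativity of
  \<open>\<delta>\<close> can be substituted when \<open>s\<close> is
  \<open>\<delta> t\<close>.\<close>

private lemma comult_\<Phi>:
  assumes s: "s \<in> carrier (tensor A T)"
  shows "comult A (\<Phi> s) = tensor_map A A id \<Phi> (tensor_assoc A A T (tensor_map (tensor A A) T (comult A) id s))"
proof (rule tensor_ext[OF complex_space_A T AA linear_map_comp[OF \<Phi> comult_linear]
      linear_map_comp[OF linear_map_comp[OF \<Delta>_id assoc_AAT] id_\<Phi>] _ s])
  fix a t assume a: "a \<in> carrier A" and t: "t \<in> carrier T"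
  \<comment> \<open>The value \<open>\<Delta>(a)\<close> need not be a simple tensor, so the
    identity is first proved for an arbitrary \<open>u\<close> in its place, where linearity allows
    a reduction to \<open>b \<otimes> c\<close>.\<close>
  have "tensor_map A A id \<Phi> (tensor_assoc A A T (tens (tensor A A) T u t)) =
      counit A (g t) \<odot>\<^bsub>tensor A A\<^esub> u" if u: "u \<in> carrier (tensor A A)" for u
  proof (rule tensor_ext[OF complex_space_A complex_space_A AA
        linear_map_comp[OF linear_map_comp[OF bilinear_map_left[OF bilinear_map_tens[OF AA T] t] assoc_AAT] id_\<Phi>]
        linear_map_scaled[OF AA linear_map_id] _ u])
    fix b c assume "b \<in> carrier A" "c \<in> carrier A"
    then show "tensor_map A A id \<Phi> (tensor_assoc A A T (tens (tensor A A) T (tens A A b c) t)) =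
        counit A (g t) \<odot>\<^bsub>tensor A A\<^esub> tens A A b c"
      using t linear_map_smult[OF bilinear_map_right[OF bilinear_map_tens[OF complex_space_A complex_space_A]]]
      by (simp add: tensor_assoc_tens[OF complex_space_A complex_space_A T] id_\<Phi>_tens \<Phi>_tens
          tens_closed[OF complex_space_A T])
  qed
  then show "comult A (\<Phi> (tens A T a t)) =
      tensor_map A A id \<Phi> (tensor_assoc A A T (tensor_map (tensor A A) T (comult A) id (tens A T a t)))"
    using a t by (simp add: \<Delta>_id_tens \<Phi>_tens linear_map_smult[OF comult_linear]
        linear_map_closed[OF comult_linear])
qed

lemma left_invariant_iff_covariant:
  "(\<forall>t\<in>carrier T. lift A (\<lambda>a t. counit A (g t) \<odot> a) (\<delta> t) = g t) \<longleftrightarrow>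
    (\<forall>t\<in>carrier T. tensor_map A A id g (\<delta> t) = comult A (g t))"
proof (intro iffI ballI)
  fix t assume t: "t \<in> carrier T"
  note \<delta>t = linear_map_closed[OF \<delta> t]
  {
    assume inv: "\<forall>t\<in>carrier T. \<Phi> (\<delta> t) = g t"
    \<comment> \<open>Invariance rewrites \<open>g t\<close> as \<open>\<Phi> (\<delta> t)\<close>,
      and coassociativity turns the inner expression of \<open>comult_\<Phi>\<close> into
      \<open>(id \<otimes> \<delta>) \<delta>\<close>.\<close>
    have "comult A (g t) = tensor_map A A id \<Phi> (tensor_map A (tensor A T) id \<delta> (\<delta> t))"
      using inv t comult_\<Phi>[OF \<delta>t] coassoc by simp
    also have "\<dots> = tensor_map A A id g (\<delta> t)"
      by (rule tensor_map_tensor_map[OF complex_space_A T complex_space_A AT complex_space_A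
            complex_space_A linear_map_id' \<delta> linear_map_id' \<Phi> _ _ \<delta>t]) (simp_all add: inv)
    finally show "tensor_map A A id g (\<delta> t) = comult A (g t)" by simp
  }
  assume cov: "\<forall>t\<in>carrier T. tensor_map A A id g (\<delta> t) = comult A (g t)"
  note \<epsilon> = bilinear_counit_smult_left[OF linear_map_id]
  note id_g = linear_map_tensor_map[OF complex_space_A T complex_space_A complex_space_A linear_map_id' g]
  \<comment> \<open>Contracting the second leg of \<open>(id \<otimes> g) \<delta> t\<close> with
    the counit gives \<open>\<Phi> (\<delta> t)\<close> for any linear \<open>g\<close>; covariance
    and the counit axiom enter only afterwards.\<close>
  have "\<Phi> (\<delta> t) = lift A (\<lambda>b c. counit A c \<odot> b) (tensor_map A A id g (\<delta> t))"
  proof (rule tensor_ext[OF complex_space_A T complex_space_A \<Phi> linear_map_comp[OF id_g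
          linear_map_lift[OF complex_space_A complex_space_A complex_space_A \<epsilon>]] _ \<delta>t])
    fix a t assume "a \<in> carrier A" "t \<in> carrier T"
    then show "\<Phi> (tens A T a t) =
        lift A (\<lambda>b c. counit A c \<odot> b) (tensor_map A A id g (tens A T a t))"
      by (simp add: \<Phi>_tens lift_tens[OF complex_space_A complex_space_A complex_space_A \<epsilon>]
          tensor_map_tens[OF complex_space_A T complex_space_A complex_space_A linear_map_id' g]
          linear_map_closed[OF g])
  qed
  then show "\<Phi> (\<delta> t) = g t"
    using cov t counit_right[OF linear_map_closed[OF g t]] by simp
qed

end

section \<open>Invariance and covariance for a right coaction\<close>

context
  fixes T :: "(complex, 't, 'x) module_scheme" and g and \<delta>
  assumes T: "complex_space T" and g: "linear_map T A g"
    and \<delta>: "linear_map T (tensor T A) \<delta>"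
    and coassoc: "\<And>t. t \<in> carrier T \<Longrightarrow>
      tensor_assoc T A A (tensor_map (tensor T A) A \<delta> id (\<delta> t)) =
      tensor_map T (tensor A A) id (comult A) (\<delta> t)"
begin

text \<open>\<open>\<Theta>\<close> is \<open>\<epsilon>g \<otimes> id\<close> on
  \<open>T \<otimes> A\<close>, and \<open>\<Psi>\<close> is the same contraction on
  \<open>T \<otimes> (A \<otimes> A)\<close>. Two maps are used because \<open>tensor_assoc\<close>
  moves brackets to the right, whereas \<open>\<Theta> \<otimes> id\<close> lives on
  \<open>(T \<otimes> A) \<otimes> A\<close>.\<close>

private abbreviation "\<Theta> \<equiv> lift A (\<lambda>t a. counit A (g t) \<odot> a)"
private abbreviation "\<Psi> \<equiv> lift (tensor A A) (\<lambda>t u. counit A (g t) \<odot>\<^bsub>tensor A A\<^esub> u)"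

private lemmas TA = complex_space_tensor[OF T complex_space_A]
private lemmas \<Theta> = linear_map_lift[OF T complex_space_A complex_space_A bilinear_counit_smult_right[OF g]]
private lemmas \<Theta>_tens = lift_tens[OF T complex_space_A complex_space_A bilinear_counit_smult_right[OF g]]
private lemmas \<Psi>_bilinear = bilinear_map_comp_args[OF bilinear_map_smult[OF AA]
        linear_map_comp[OF g counit_linear] linear_map_id]
private lemmas \<Psi> = linear_map_lift[OF T AA AA \<Psi>_bilinear]
private lemmas \<Psi>_tens = lift_tens[OF T AA AA \<Psi>_bilinear]
private lemmas \<Theta>_id = linear_map_tensor_map[OF TA complex_space_A complex_space_A complex_space_A \<Theta> linear_map_id']
private lemmas \<Theta>_id_tens = tensor_map_tens[OF TA complex_space_A complex_space_A complex_space_A \<Theta> linear_map_id']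
private lemmas id_\<Delta> = linear_map_tensor_map[OF T complex_space_A T AA linear_map_id' comult_linear]
private lemmas id_\<Delta>_tens = tensor_map_tens[OF T complex_space_A T AA linear_map_id' comult_linear]
private lemmas assoc_TAA = linear_map_tensor_assoc[OF T complex_space_A complex_space_A]

private lemma comult_\<Theta>:
  assumes s: "s \<in> carrier (tensor T A)"
  shows "comult A (\<Theta> s) = \<Psi> (tensor_map T (tensor A A) id (comult A) s)"
proof (rule tensor_ext[OF T complex_space_A AA linear_map_comp[OF \<Theta> comult_linear]
      linear_map_comp[OF id_\<Delta> \<Psi>] _ s])
  fix t a assume "t \<in> carrier T" "a \<in> carrier A"
  then show "comult A (\<Theta> (tens T A t a)) = \<Psi> (tensor_map T (tensor A A) id (comult A) (tens T A t a))"
    by (simp add: \<Theta>_tens \<Psi>_tens id_\<Delta>_tens linear_map_smult[OF comult_linear]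
        linear_map_closed[OF comult_linear])
qed

text \<open>Both maps contract the leg in \<open>T\<close> with \<open>\<epsilon>g\<close>; the
  resulting scalar may be taken out of the first leg of \<open>A \<otimes> A\<close>.\<close>

private lemma \<Psi>_assoc:
  assumes s: "s \<in> carrier (tensor (tensor T A) A)"
  shows "\<Psi> (tensor_assoc T A A s) = tensor_map A A \<Theta> id s"
proof (rule tensor_ext[OF TA complex_space_A AA linear_map_comp[OF assoc_TAA \<Psi>] \<Theta>_id _ s])
  fix u a assume u: "u \<in> carrier (tensor T A)" and a: "a \<in> carrier A"
  note lin = bilinear_map_left[OF bilinear_map_tens[OF TA complex_space_A] a]
  show "\<Psi> (tensor_assoc T A A (tens (tensor T A) A u a)) =
      tensor_map A A \<Theta> id (tens (tensor T A) A u a)"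
  proof (rule tensor_ext[OF T complex_space_A AA linear_map_comp[OF lin linear_map_comp[OF assoc_TAA \<Psi>]]
        linear_map_comp[OF lin \<Theta>_id] _ u])
    fix t b assume "t \<in> carrier T" "b \<in> carrier A"
    then show "\<Psi> (tensor_assoc T A A (tens (tensor T A) A (tens T A t b) a)) =
        tensor_map A A \<Theta> id (tens (tensor T A) A (tens T A t b) a)"
      using a linear_map_smult[OF bilinear_map_left[OF bilinear_map_tens[OF complex_space_A complex_space_A] a]]
      by (simp add: tensor_assoc_tens[OF T complex_space_A complex_space_A] \<Theta>_id_tens \<Theta>_tens \<Psi>_tens
          tens_closed[OF T complex_space_A] tens_closed[OF complex_space_A complex_space_A])
  qed
qed

lemma right_invariant_iff_covariant:
  "(\<forall>t\<in>carrier T. lift A (\<lambda>t a. counit A (g t) \<odot> a) (\<delta> t) = g t) \<longleftrightarrow>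
    (\<forall>t\<in>carrier T. tensor_map A A g id (\<delta> t) = comult A (g t))"
proof (intro iffI ballI)
  fix t assume t: "t \<in> carrier T"
  note \<delta>t = linear_map_closed[OF \<delta> t]
  {
    assume inv: "\<forall>t\<in>carrier T. \<Theta> (\<delta> t) = g t"
    note \<delta>_id = linear_map_tensor_map[OF T complex_space_A TA complex_space_A \<delta> linear_map_id']
    \<comment> \<open>The chain is \<open>\<Delta> \<Theta> \<delta> = \<Psi> (id \<otimes>
      \<Delta>) \<delta> = \<Psi> assoc (\<delta> \<otimes> id) \<delta>\<close>, ended by
      \<open>\<Psi>_assoc\<close>; coassociativity is therefore used from right to left.\<close>
    have "comult A (g t) = tensor_map A A \<Theta> id (tensor_map (tensor T A) A \<delta> id (\<delta> t))"
      using inv t comult_\<Theta>[OF \<delta>t] coassoc[symmetric] \<Psi>_assoc[OF linear_map_closed[OF \<delta>_id \<delta>t]]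
      by simp
    also have "\<dots> = tensor_map A A g id (\<delta> t)"
      by (rule tensor_map_tensor_map[OF T complex_space_A TA complex_space_A complex_space_A
            complex_space_A \<delta> linear_map_id' \<Theta> linear_map_id' _ _ \<delta>t]) (simp_all add: inv)
    finally show "tensor_map A A g id (\<delta> t) = comult A (g t)" by simp
  }
  assume cov: "\<forall>t\<in>carrier T. tensor_map A A g id (\<delta> t) = comult A (g t)"
  note \<epsilon> = bilinear_counit_smult_right[OF linear_map_id]
  note g_id = linear_map_tensor_map[OF T complex_space_A complex_space_A complex_space_A g linear_map_id']
  have "\<Theta> (\<delta> t) = lift A (\<lambda>b c. counit A b \<odot> c) (tensor_map A A g id (\<delta> t))"
  proof (rule tensor_ext[OF T complex_space_A complex_space_A \<Theta> linear_map_comp[OF g_id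
          linear_map_lift[OF complex_space_A complex_space_A complex_space_A \<epsilon>]] _ \<delta>t])
    fix t a assume "t \<in> carrier T" "a \<in> carrier A"
    then show "\<Theta> (tens T A t a) =
        lift A (\<lambda>b c. counit A b \<odot> c) (tensor_map A A g id (tens T A t a))"
      by (simp add: \<Theta>_tens lift_tens[OF complex_space_A complex_space_A complex_space_A \<epsilon>]
          tensor_map_tens[OF T complex_space_A complex_space_A complex_space_A g linear_map_id']
          linear_map_closed[OF g])
  qed
  then show "\<Theta> (\<delta> t) = g t"
    using cov t counit_left[OF linear_map_closed[OF g t]] by simp
qed

end

end

section \<open>The coactions on a tensor product over the Hopf algebra\<close>

text \<open>Allowing two different bimodules keeps the factors apart by type; the theorem takes both
  equal to \<open>E\<close>.\<close>

locale bicovariant_pair = hopf_algebra A + M: bicovariant_bimodule A M + N: bicovariant_bimodule A N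
  for A :: "'a hopf_alg" (structure) and M :: "('a, 'm) bicov" and N :: "('a, 'n) bicov"
begin

abbreviation "T \<equiv> tensor_by (balancing_relations A M N) M N"
abbreviation "tau \<equiv> tens_over A M N"

lemmas sA = complex_space_A and sM = M.module_axioms and sN = N.module_axioms

sublocale T: tensor_relations "balancing_relations A M N" M N
proof (rule tensor_relations.intro[OF sM sN])
  show "balancing_relations A M N \<subseteq> carrier (free_space (carrier M \<times> carrier N))"
    unfolding balancing_relations_def
    by clarify (intro free_space_diff_closed; auto intro: bilinear_map_closed[OF M.ract_bilinear]
      bilinear_map_closed[OF N.lact_bilinear])
qed

lemmas sT = T.complex_space_tensor_by

lemma tau_bilinear: "bilinear_map M N T tau"
  unfolding tens_over_def by (rule T.bilinear_map_tens_by)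

lemma tau_balanced:
  assumes "m \<in> carrier M" "a \<in> carrier A" "n \<in> carrier N"
  shows "tau (ract M m a) n = tau m (lact N a n)"
  unfolding tens_over_def tens_by_def
proof (rule T.relation_coset_eq)
  show "pair_of (ract M m a) n - pair_of m (lact N a n) \<in> bilinear_relations M N \<union> balancing_relations A M N"
    using assms unfolding balancing_relations_def by blast
qed (use assms in \<open>auto intro: bilinear_map_closed[OF M.ract_bilinear]
      bilinear_map_closed[OF N.lact_bilinear]\<close>)

text \<open>Universal property over \<open>A\<close>. A balancing relation evaluates to the
  difference of \<open>\<beta> (ract M m a) n\<close> and \<open>\<beta> m (lact N a n)\<close>,
  which \<open>bal\<close> makes zero.\<close>

lemma linear_map_lift_balanced:
  assumes P: "complex_space P" and b: "bilinear_map M N P \<beta>"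
    and bal: "\<And>m a n. \<lbrakk>m \<in> carrier M; a \<in> carrier A; n \<in> carrier N\<rbrakk> \<Longrightarrow>
      \<beta> (ract M m a) n = \<beta> m (lact N a n)"
  shows "linear_map T P (lift P \<beta>)"
    and "\<lbrakk>m \<in> carrier M; n \<in> carrier N\<rbrakk> \<Longrightarrow> lift P \<beta> (tau m n) = \<beta> m n"
proof -
  interpret P: module complex_alg P by (rule P)
  have rel: "eval_formal P \<beta> x = \<zero>\<^bsub>P\<^esub>" if x: "x \<in> balancing_relations A M N" for x
  proof -
    obtain m a n where xd: "x = pair_of (ract M m a) n - pair_of m (lact N a n)"
      and c: "m \<in> carrier M" "a \<in> carrier A" "n \<in> carrier N"
      using x unfolding balancing_relations_def by blast
    have cl: "ract M m a \<in> carrier M" "lact N a n \<in> carrier N"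
      using bilinear_map_closed[OF M.ract_bilinear] bilinear_map_closed[OF N.lact_bilinear] c by auto
    have lin: "linear_map (free_space (carrier M \<times> carrier N)) P (eval_formal P \<beta>)"
      by (rule linear_map_eval_formal[OF P]) (auto intro: bilinear_map_closed[OF b])
    have single: "eval_formal P \<beta> (Poly_Mapping.single (m, n) k) = k \<odot>\<^bsub>P\<^esub> \<beta> m n"
      if "m \<in> carrier M" "n \<in> carrier N" for m n k
      by (rule eval_formal_single[where \<beta> = \<beta>, OF P bilinear_map_closed[OF b that]])
    have one: "1 \<odot>\<^bsub>P\<^esub> y = y" if "y \<in> carrier P" for y using P.smult_one[OF that] by simp
    show ?thesis
      unfolding xd linear_map_free_diff[OF P lin T.single_closed[OF cl(1) c(3)] T.single_closed[OF c(1) cl(2)]]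
      by (simp add: single c cl one bilinear_map_closed[OF b] bal a_minus_def P.r_neg)
  qed
  show "linear_map T P (lift P \<beta>)" by (rule T.linear_map_lift_by[OF P b rel])
  show "lift P \<beta> (tau m n) = \<beta> m n" if "m \<in> carrier M" "n \<in> carrier N"
    unfolding tens_over_def by (rule T.lift_tens_by[OF P b rel that])
qed

text \<open>\<open>mu_left\<close> is the product \<open>(a \<otimes> m) (b \<otimes> n) = a b
  \<otimes> (m \<otimes>\<^sub>A n)\<close>, with values in \<open>A \<otimes> T\<close>;
  \<open>mu_right\<close> is its mirror image. Applied to the two coactions, they yield the
  coactions on \<open>T\<close>.\<close>

abbreviation "mu_left \<equiv> tensor_mult A T (mult A) tau"
abbreviation "mu_right \<equiv> tensor_mult T A tau (mult A)"

lemmas mu_left = bilinear_map_tensor_mult[OF sA sA sA sM sN sT mult_bilinear tau_bilinear]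
  and mu_left_tens = tensor_mult_tens[OF sA sA sA sM sN sT mult_bilinear tau_bilinear]
  and mu_right = bilinear_map_tensor_mult[OF sM sN sT sA sA sA tau_bilinear mult_bilinear]
  and mu_right_tens = tensor_mult_tens[OF sM sN sT sA sA sA tau_bilinear mult_bilinear]

abbreviation "coact_left \<equiv> lift (tensor A T) (\<lambda>m n. mu_left (lcoact M m) (lcoact N n))"
abbreviation "coact_right \<equiv> lift (tensor T A) (\<lambda>m n. mu_right (rcoact M m) (rcoact N n))"

lemmas AT = complex_space_tensor[OF sA sT] and TA = complex_space_tensor[OF sT sA]

text \<open>On simple tensors this is associativity of \<open>A\<close> in the first leg and
  \<open>tau_balanced\<close> in the second. It will be used with \<open>u = \<Delta>(a)\<close>,
  which need not be simple.\<close>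

lemma mu_left_balanced:
  assumes s: "s \<in> carrier (tensor A M)" and u: "u \<in> carrier (tensor A A)"
    and t: "t \<in> carrier (tensor A N)"
  shows "mu_left (tensor_mult A M (mult A) (ract M) s u) t =
    mu_left s (tensor_mult A N (mult A) (lact N) u t)"
proof -
  note r = bilinear_map_tensor_mult[OF sA sA sA sM sA sM mult_bilinear M.ract_bilinear]
    and l = bilinear_map_tensor_mult[OF sA sA sA sA sN sN mult_bilinear N.lact_bilinear]
  note tens_simps = mu_left_tens
    tensor_mult_tens[OF sA sA sA sM sA sM mult_bilinear M.ract_bilinear]
    tensor_mult_tens[OF sA sA sA sA sN sN mult_bilinear N.lact_bilinear]
    bilinear_map_closed[OF M.ract_bilinear] bilinear_map_closed[OF N.lact_bilinear]
    tens_closed[OF sA sM] tens_closed[OF sA sN] tens_closed[OF sA sA] tau_balanced m_assoc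
  show ?thesis
  proof (rule tensor_ext[OF sA sA AT linear_map_comp[OF bilinear_map_right[OF r s] bilinear_map_left[OF mu_left t]]
        linear_map_comp[OF bilinear_map_left[OF l t] bilinear_map_right[OF mu_left s]] _ u])
    fix b c assume bc: "b \<in> carrier A" "c \<in> carrier A"
    note bct = tens_closed[OF sA sA bc]
    show "mu_left (tensor_mult A M (mult A) (ract M) s (tens A A b c)) t =
        mu_left s (tensor_mult A N (mult A) (lact N) (tens A A b c) t)"
    proof (rule bilinear_tensor_ext[OF sA sM sA sN AT
          bilinear_map_comp_args[OF mu_left bilinear_map_left[OF r bct] linear_map_id]
          bilinear_map_comp_args[OF mu_left linear_map_id bilinear_map_right[OF l bct]] _ s t])
    qed (use bc in \<open>simp add: tens_simps\<close>)
  qed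
qed

text \<open>Mirror image: balancing acts in the first leg and associativity in the second.\<close>

lemma mu_right_balanced:
  assumes s: "s \<in> carrier (tensor M A)" and u: "u \<in> carrier (tensor A A)"
    and t: "t \<in> carrier (tensor N A)"
  shows "mu_right (tensor_mult M A (ract M) (mult A) s u) t =
    mu_right s (tensor_mult N A (lact N) (mult A) u t)"
proof -
  note r = bilinear_map_tensor_mult[OF sM sA sM sA sA sA M.ract_bilinear mult_bilinear]
    and l = bilinear_map_tensor_mult[OF sA sN sN sA sA sA N.lact_bilinear mult_bilinear]
  note tens_simps = mu_right_tens
    tensor_mult_tens[OF sM sA sM sA sA sA M.ract_bilinear mult_bilinear]
    tensor_mult_tens[OF sA sN sN sA sA sA N.lact_bilinear mult_bilinear]
    bilinear_map_closed[OF M.ract_bilinear] bilinear_map_closed[OF N.lact_bilinear]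
    tens_closed[OF sM sA] tens_closed[OF sN sA] tens_closed[OF sA sA] tau_balanced m_assoc
  show ?thesis
  proof (rule tensor_ext[OF sA sA TA linear_map_comp[OF bilinear_map_right[OF r s] bilinear_map_left[OF mu_right t]]
        linear_map_comp[OF bilinear_map_left[OF l t] bilinear_map_right[OF mu_right s]] _ u])
    fix b c assume bc: "b \<in> carrier A" "c \<in> carrier A"
    note bct = tens_closed[OF sA sA bc]
    show "mu_right (tensor_mult M A (ract M) (mult A) s (tens A A b c)) t =
        mu_right s (tensor_mult N A (lact N) (mult A) (tens A A b c) t)"
    proof (rule bilinear_tensor_ext[OF sM sA sN sA TA
          bilinear_map_comp_args[OF mu_right bilinear_map_left[OF r bct] linear_map_id]
          bilinear_map_comp_args[OF mu_right linear_map_id bilinear_map_right[OF l bct]] _ s t])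
    qed (use bc in \<open>simp add: tens_simps\<close>)
  qed
qed

text \<open>The coaction formula is balanced because \<open>lcoact\<close> turns both the right
  action on \<open>M\<close> and the left action on \<open>N\<close> into multiplication by
  \<open>\<Delta>(a)\<close>, which \<open>mu_left_balanced\<close> passes across.\<close>

lemma coact_left:
  shows linear_map_coact_left: "linear_map T (tensor A T) coact_left"
    and coact_left_tau: "\<lbrakk>m \<in> carrier M; n \<in> carrier N\<rbrakk> \<Longrightarrow>
      coact_left (tau m n) = mu_left (lcoact M m) (lcoact N n)"
proof -
  have b: "bilinear_map M N (tensor A T) (\<lambda>m n. mu_left (lcoact M m) (lcoact N n))"
    by (rule bilinear_map_comp_args[OF mu_left M.lcoact_linear N.lcoact_linear])
  have bal: "mu_left (lcoact M (ract M m a)) (lcoact N n) = mu_left (lcoact M m) (lcoact N (lact N a n))"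
    if "m \<in> carrier M" "a \<in> carrier A" "n \<in> carrier N" for m a n
    using that mu_left_balanced[OF linear_map_closed[OF M.lcoact_linear]
        linear_map_closed[OF comult_linear] linear_map_closed[OF N.lcoact_linear]]
    by (simp add: M.lcoact_ract N.lcoact_lact)
  show "linear_map T (tensor A T) coact_left"
    and "\<lbrakk>m \<in> carrier M; n \<in> carrier N\<rbrakk> \<Longrightarrow> coact_left (tau m n) = mu_left (lcoact M m) (lcoact N n)"
    using linear_map_lift_balanced[OF AT b bal] by blast+
qed

lemma coact_right:
  shows linear_map_coact_right: "linear_map T (tensor T A) coact_right"
    and coact_right_tau: "\<lbrakk>m \<in> carrier M; n \<in> carrier N\<rbrakk> \<Longrightarrow>
      coact_right (tau m n) = mu_right (rcoact M m) (rcoact N n)"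
proof -
  have b: "bilinear_map M N (tensor T A) (\<lambda>m n. mu_right (rcoact M m) (rcoact N n))"
    by (rule bilinear_map_comp_args[OF mu_right M.rcoact_linear N.rcoact_linear])
  have bal: "mu_right (rcoact M (ract M m a)) (rcoact N n) = mu_right (rcoact M m) (rcoact N (lact N a n))"
    if "m \<in> carrier M" "a \<in> carrier A" "n \<in> carrier N" for m a n
    using that mu_right_balanced[OF linear_map_closed[OF M.rcoact_linear]
        linear_map_closed[OF comult_linear] linear_map_closed[OF N.rcoact_linear]]
    by (simp add: M.rcoact_ract N.rcoact_lact)
  show "linear_map T (tensor T A) coact_right"
    and "\<lbrakk>m \<in> carrier M; n \<in> carrier N\<rbrakk> \<Longrightarrow> coact_right (tau m n) = mu_right (rcoact M m) (rcoact N n)"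
    using linear_map_lift_balanced[OF TA b bal] by blast+
qed

section \<open>Coassociativity of the coactions on \<open>T\<close>\<close>

lemma coact_left_coassoc:
  assumes t: "t \<in> carrier T"
  shows "tensor_assoc A A T (tensor_map (tensor A A) T (comult A) id (coact_left t)) =
    tensor_map A (tensor A T) id coact_left (coact_left t)"
proof (rule T.tensor_by_ext[OF complex_space_tensor[OF sA AT] linear_map_comp[OF linear_map_coact_left
        linear_map_comp[OF linear_map_tensor_map[OF sA sT AA sT comult_linear linear_map_id']
          linear_map_tensor_assoc[OF sA sA sT]]]
      linear_map_comp[OF linear_map_coact_left linear_map_tensor_map[OF sA sT sA AT linear_map_id'
          linear_map_coact_left]] _ t, folded tens_over_def])
  fix m n assume m: "m \<in> carrier M" and n: "n \<in> carrier N"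
  note AM = complex_space_tensor[OF sA sM] and AN = complex_space_tensor[OF sA sN]
  note lm = linear_map_closed[OF M.lcoact_linear m] and ln = linear_map_closed[OF N.lcoact_linear n]
  \<comment> \<open>\<open>\<Delta> \<otimes> id\<close> respects the product because
    \<open>\<Delta>\<close> is multiplicative (\<open>comult_mult\<close>).\<close>
  have "tensor_assoc A A T (tensor_map (tensor A A) T (comult A) id (mu_left (lcoact M m) (lcoact N n))) =
      tensor_assoc A A T (tensor_mult (tensor A A) T (tensor_mult A A (mult A) (mult A)) tau
        (tensor_map (tensor A A) M (comult A) id (lcoact M m))
        (tensor_map (tensor A A) N (comult A) id (lcoact N n)))"
    by (subst tensor_map_tensor_mult[OF sA sA sA sM sN sT AA AA AA sM sN sT
          comult_linear comult_linear comult_linear linear_map_id' linear_map_id' linear_map_id'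
          mult_bilinear tau_bilinear
          bilinear_map_tensor_mult[OF sA sA sA sA sA sA mult_bilinear mult_bilinear] tau_bilinear
          _ _ lm ln]) (simp_all add: comult_mult)
  \<comment> \<open>Coassociativity of the coactions on \<open>M\<close> and \<open>N\<close> is
    rewritten backwards, so that both factors have the form to which the associator lemma
    applies.\<close>
  also have "\<dots> = tensor_mult A (tensor A T) (mult A) mu_left
      (tensor_map A (tensor A M) id (lcoact M) (lcoact M m))
      (tensor_map A (tensor A N) id (lcoact N) (lcoact N n))"
    unfolding M.lcoact_coassoc[OF m, symmetric] N.lcoact_coassoc[OF n, symmetric]
    by (rule tensor_assoc_tensor_mult[OF sA sA sA sA sA sA sM sN sT mult_bilinear mult_bilinear tau_bilinear
          linear_map_closed[OF linear_map_tensor_map[OF sA sM AA sM comult_linear linear_map_id'] lm]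
          linear_map_closed[OF linear_map_tensor_map[OF sA sN AA sN comult_linear linear_map_id'] ln]])
  \<comment> \<open>Here \<open>id \<otimes> coact_left\<close> respects the product: in the second
    leg this is the formula \<open>coact_left_tau\<close>.\<close>
  also have "\<dots> = tensor_map A (tensor A T) id coact_left (mu_left (lcoact M m) (lcoact N n))"
    by (subst tensor_map_tensor_mult[OF sA sA sA sM sN sT sA sA sA AM AN AT
          linear_map_id' linear_map_id' linear_map_id' M.lcoact_linear N.lcoact_linear linear_map_coact_left
          mult_bilinear tau_bilinear mult_bilinear mu_left _ _ lm ln]) (simp_all add: coact_left_tau)
  finally show "tensor_assoc A A T (tensor_map (tensor A A) T (comult A) id (coact_left (tau m n))) =
      tensor_map A (tensor A T) id coact_left (coact_left (tau m n))"
    by (simp add: coact_left_tau m n)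
qed

lemma coact_right_coassoc:
  assumes t: "t \<in> carrier T"
  shows "tensor_assoc T A A (tensor_map (tensor T A) A coact_right id (coact_right t)) =
    tensor_map T (tensor A A) id (comult A) (coact_right t)"
proof (rule T.tensor_by_ext[OF complex_space_tensor[OF sT AA] linear_map_comp[OF linear_map_coact_right
        linear_map_comp[OF linear_map_tensor_map[OF sT sA TA sA linear_map_coact_right linear_map_id']
          linear_map_tensor_assoc[OF sT sA sA]]]
      linear_map_comp[OF linear_map_coact_right linear_map_tensor_map[OF sT sA sT AA linear_map_id'
          comult_linear]] _ t, folded tens_over_def])
  fix m n assume m: "m \<in> carrier M" and n: "n \<in> carrier N"
  note MA = complex_space_tensor[OF sM sA] and NA = complex_space_tensor[OF sN sA]
  note rm = linear_map_closed[OF M.rcoact_linear m] and rn = linear_map_closed[OF N.rcoact_linear n]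
  \<comment> \<open>In contrast to the left case, the formula for the coaction is used first, and
    multiplicativity of \<open>\<Delta>\<close> at the end.\<close>
  have "tensor_assoc T A A (tensor_map (tensor T A) A coact_right id (mu_right (rcoact M m) (rcoact N n))) =
      tensor_assoc T A A (tensor_mult (tensor T A) A mu_right (mult A)
        (tensor_map (tensor M A) A (rcoact M) id (rcoact M m))
        (tensor_map (tensor N A) A (rcoact N) id (rcoact N n)))"
    by (subst tensor_map_tensor_mult[OF sM sN sT sA sA sA MA NA TA sA sA sA
          M.rcoact_linear N.rcoact_linear linear_map_coact_right linear_map_id' linear_map_id' linear_map_id'
          tau_bilinear mult_bilinear mu_right mult_bilinear _ _ rm rn]) (simp_all add: coact_right_tau)
  also have "\<dots> = tensor_mult T (tensor A A) tau (tensor_mult A A (mult A) (mult A))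
      (tensor_map M (tensor A A) id (comult A) (rcoact M m))
      (tensor_map N (tensor A A) id (comult A) (rcoact N n))"
    unfolding M.rcoact_coassoc[OF m, symmetric] N.rcoact_coassoc[OF n, symmetric]
    by (rule tensor_assoc_tensor_mult[OF sM sN sT sA sA sA sA sA sA tau_bilinear mult_bilinear mult_bilinear
          linear_map_closed[OF linear_map_tensor_map[OF sM sA MA sA M.rcoact_linear linear_map_id'] rm]
          linear_map_closed[OF linear_map_tensor_map[OF sN sA NA sA N.rcoact_linear linear_map_id'] rn]])
  also have "\<dots> = tensor_map T (tensor A A) id (comult A) (mu_right (rcoact M m) (rcoact N n))"
    by (subst tensor_map_tensor_mult[OF sM sN sT sA sA sA sM sN sT AA AA AA
          linear_map_id' linear_map_id' linear_map_id' comult_linear comult_linear comult_linear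
          tau_bilinear mult_bilinear tau_bilinear
          bilinear_map_tensor_mult[OF sA sA sA sA sA sA mult_bilinear mult_bilinear]
          _ _ rm rn]) (simp_all add: comult_mult)
  finally show "tensor_assoc T A A (tensor_map (tensor T A) A coact_right id (coact_right (tau m n))) =
      tensor_map T (tensor A A) id (comult A) (coact_right (tau m n))"
    by (simp add: coact_right_tau m n)
qed

end

section \<open>The metric as a linear map on the comodule \<open>T\<close>\<close>

theorem proposition3p3:
  fixes A :: "'a hopf_alg" and E :: "('a, 'e) bicov" and g :: "('e, 'e) tens \<Rightarrow> 'a"
  assumes "hopf_algebra A"
    and "bicovariant_bimodule A E"
    and "finite_bicovariant A E"
    and "pseudo_Riemannian_metric A E g"
  shows "(left_invariant A E g \<longleftrightarrow>
            (\<forall>t\<in>carrier (tensor_over A E E).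
               tensor_map A A id g (lcoact (tensor_over A E E) t) = comult A (g t))) \<and>
         (right_invariant A E g \<longleftrightarrow>
            (\<forall>t\<in>carrier (tensor_over A E E).
               tensor_map A A g id (rcoact (tensor_over A E E) t) = comult A (g t)))"
proof -
  interpret bicovariant_pair A E E
    using assms by (simp add: bicovariant_pair_def)
  \<comment> \<open>\<open>tensor_over\<close> adds actions and coactions to the vector space
    \<open>T\<close>; its coaction fields are literally the lifts studied above.\<close>
  have carrier: "carrier (tensor_over A E E) = carrier T"
    and lcoact: "lcoact (tensor_over A E E) = coact_left"
    and rcoact: "rcoact (tensor_over A E E) = coact_right"
    by (simp_all add: tensor_over_def Let_def)
  \<comment> \<open>\<open>linear_map\<close> looks only at carrier, addition and scalar
    multiplication, which \<open>tensor_over\<close> copies from \<open>T\<close>.\<close>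
  have g: "linear_map T A g"
    using pseudo_Riemannian_metric.metric_linear[OF assms(4)]
    by (simp add: linear_map_def tensor_over_def Let_def)
  \<comment> \<open>Invariance is imposed on simple tensors only, while the general equivalence
    speaks of all \<open>t\<close>; linearity of both sides closes the gap.\<close>
  have ext: "(\<forall>\<rho>\<in>carrier E. \<forall>\<nu>\<in>carrier E. f (tau \<rho> \<nu>) = g (tau \<rho> \<nu>)) \<longleftrightarrow>
      (\<forall>t\<in>carrier T. f t = g t)" if "linear_map T A f" for f
    using T.tensor_by_ext[OF sA that g] T.tens_by_closed unfolding tens_over_def by blast
  have "left_invariant A E g \<longleftrightarrow>
      (\<forall>t\<in>carrier T. lift A (\<lambda>a t. counit A (g t) \<odot>\<^bsub>A\<^esub> a) (coact_left t) = g t)"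
    unfolding left_invariant_def lcoact
    by (rule ext) (rule linear_map_comp[OF linear_map_coact_left
          linear_map_lift[OF sA sT sA bilinear_counit_smult_left[OF g]]])
  moreover have "right_invariant A E g \<longleftrightarrow>
      (\<forall>t\<in>carrier T. lift A (\<lambda>t a. counit A (g t) \<odot>\<^bsub>A\<^esub> a) (coact_right t) = g t)"
    unfolding right_invariant_def rcoact
    by (rule ext) (rule linear_map_comp[OF linear_map_coact_right
          linear_map_lift[OF sT sA sA bilinear_counit_smult_right[OF g]]])
  ultimately show ?thesis
    unfolding carrier lcoact rcoact
    using left_invariant_iff_covariant[OF sT g linear_map_coact_left coact_left_coassoc]
      right_invariant_iff_covariant[OF sT g linear_map_coact_right coact_right_coassoc]
    by simp
qed

end
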